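(* Let $k_1,\ldots,k_n\ge 2$ be integers, $G=[0,k_1-1]\times\cdots\times[0,k_n-1]$ and $N=\sum_{i=1}^n(k_i-1)$. Let $I=[c,d]\subseteq[0,N]$ be an integer interval and let $E=\{w_t:t\in I\}\subseteq[0,N]$ be a set of distinct integers that is $I$-compatible. Then \[ \mathrm{H}_d(\underline{E})=\sum_{t\in I}\min\bigg\{\genfrac{[}{]}{0pt}{}{G}{t},\genfrac{[}{]}{0pt}{}{G}{w_t}\bigg\}. \]
   Context: For integers $a\le b$, $[a,b]$ is the set of integers between $a$ and $b$. For $x\in G$, $\mathrm{wt}(x)=\sum_i x_i$; for a set of integers $F$, $\underline{F}=\{x\in G:\mathrm{wt}(x)\in F\}$, $\underline{j}=\underline{\{j\}}$, $\genfrac{[}{]}{0pt}{}{G}{j}=|\underline{j}|$. $\mathrm{H}_d(A)$ is the dimension of the real vector space of functions $A\to\mathbb{R}$ representable by a real polynomial of degree at most $d$. For $I=[c,d]$, a set $E=\{w_t:t\in I\}$ of distinct integers is $I$-compatible if: (i) $w_t\ge t$ for all $t\in I$; (ii) for $t\in I$, if $w_t\ne t$ then $w_t>d$; (iii) for $s,t\in I$ with $s<t$, if $w_s,w_t\notin I$ then $w_t<w_s$. *)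

theory Defs
  imports
    "HOL-Analysis.Analysis"
    "HOL-Library.Poly_Mapping"
    "HOL-Library.Function_Algebras"
begin

(* Points of the n-dimensional grid are functions on {1..n}, extended by undefined elsewhere. *)
definition grid :: "nat \<Rightarrow> (nat \<Rightarrow> nat) \<Rightarrow> (nat \<Rightarrow> nat) set" where
  "grid n k = PiE {1..n} (\<lambda>i. {0..k i - 1})"

definition wt :: "nat \<Rightarrow> (nat \<Rightarrow> nat) \<Rightarrow> nat" where
  "wt n x = (\<Sum>i\<in>{1..n}. x i)"

definition layers :: "nat \<Rightarrow> (nat \<Rightarrow> nat) \<Rightarrow> nat set \<Rightarrow> (nat \<Rightarrow> nat) set" where
  "layers n k F = {x \<in> grid n k. wt n x \<in> F}"

definition layer_size :: "nat \<Rightarrow> (nat \<Rightarrow> nat) \<Rightarrow> nat \<Rightarrow> nat" where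
  "layer_size n k j = card (layers n k {j})"

(* A polynomial is a finitely supported map from monomials to coefficients, and a monomial is
   a finitely supported map from indices of variables to exponents. *)
type_synonym mpoly = "(nat \<Rightarrow>\<^sub>0 nat) \<Rightarrow>\<^sub>0 real"

definition monom_deg :: "(nat \<Rightarrow>\<^sub>0 nat) \<Rightarrow> nat" where
  "monom_deg m = (\<Sum>i\<in>Poly_Mapping.keys m. Poly_Mapping.lookup m i)"

definition polys_upto :: "nat \<Rightarrow> nat \<Rightarrow> mpoly set" where
  "polys_upto n d =
     {p. \<forall>m\<in>Poly_Mapping.keys p. Poly_Mapping.keys m \<subseteq> {1..n} \<and> monom_deg m \<le> d}"

definition peval :: "mpoly \<Rightarrow> (nat \<Rightarrow> real) \<Rightarrow> real" where
  "peval p x =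
     (\<Sum>m\<in>Poly_Mapping.keys p. Poly_Mapping.lookup p m *
        (\<Prod>i\<in>Poly_Mapping.keys m. x i ^ Poly_Mapping.lookup m i))"

definition fscale :: "real \<Rightarrow> ('a \<Rightarrow> real) \<Rightarrow> 'a \<Rightarrow> real" where
  "fscale c f = (\<lambda>x. c * f x)"

interpretation fun_vs: vector_space "fscale :: real \<Rightarrow> ('a \<Rightarrow> real) \<Rightarrow> 'a \<Rightarrow> real"
  by unfold_locales (auto simp: fscale_def fun_eq_iff algebra_simps)

(* A function A \<rightarrow> \<real> is encoded by its extension by 0 outside A. *)
definition poly_funs :: "nat \<Rightarrow> nat \<Rightarrow> (nat \<Rightarrow> nat) set \<Rightarrow> ((nat \<Rightarrow> nat) \<Rightarrow> real) set" where
  "poly_funs n d A =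
     {f. (\<forall>x. x \<notin> A \<longrightarrow> f x = 0) \<and>
         (\<exists>p\<in>polys_upto n d. \<forall>x\<in>A. f x = peval p (\<lambda>i. real (x i)))}"

definition hilb :: "nat \<Rightarrow> nat \<Rightarrow> (nat \<Rightarrow> nat) set \<Rightarrow> nat" where
  "hilb n d A = vector_space.dim fscale (poly_funs n d A)"

(* The labelling w is part of the data: the compatible set is E = w ` {c..d}. *)
definition compatible :: "nat \<Rightarrow> nat \<Rightarrow> (nat \<Rightarrow> nat) \<Rightarrow> bool" where
  "compatible c d w \<longleftrightarrow>
     inj_on w {c..d} \<and>
     (\<forall>t\<in>{c..d}. t \<le> w t) \<and>
     (\<forall>t\<in>{c..d}. w t \<noteq> t \<longrightarrow> d < w t) \<and>
     (\<forall>s\<in>{c..d}. \<forall>t\<in>{c..d}. s < t \<longrightarrow> w s \<notin> {c..d} \<longrightarrow> w t \<notin> {c..d} \<longrightarrow> w t < w s)"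

end

theory Submission
  imports Defs
begin

text \<open>
  The functions on the grid form a module over sl2 in which layer \<open>j\<close> is a weight space, so they
  have a basis consisting of strings: a string starting in layer \<open>m\<close> has one vector in each of the
  layers \<open>m, \<dots>, N - m\<close>, and the size of layer \<open>j\<close> is the number of strings with
  \<open>m \<le> min j (N - j)\<close>. The polynomial functions of degree at most \<open>d\<close> are the image of the layers
  \<open>0, \<dots>, d\<close> under the exponential of the raising operator, because its matrix entries are products
  of binomial coefficients. It preserves strings, and on a single string it is multiplication by
  a polynomial of degree at most \<open>d - m\<close> in the weight. Restricted to the layers in \<open>E\<close>, a string
  therefore contributes the rank of a Vandermonde matrix, so the Hilbert function is the sum over
  all strings of the minimum of \<open>d - m + 1\<close> (or 0 if \<open>m > d\<close>) and the number of elements of \<open>E\<close>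
  between \<open>m\<close> and \<open>N - m\<close>. Compatibility makes this minimum equal to the number of \<open>t\<close> for which
  both \<open>t\<close> and \<open>w t\<close> lie in that range, and exchanging the sums gives the formula.
\<close>

section \<open>Linearly independent families of functions\<close>

lemma sum_fun_apply: "(\<Sum>s\<in>T. f s) x = (\<Sum>s\<in>T. f s x :: real)"
  by (induction T rule: infinite_finite_induct) auto

lemma sum_fscale: "(\<Sum>s\<in>T. fscale (c s) (u s)) = (\<lambda>x. \<Sum>s\<in>T. c s * u s x)"
  by (rule ext) (simp add: sum_fun_apply fscale_def)

text \<open>Coefficients are attached to labels in \<open>T\<close> rather than to functions, so
  relations can be handled pointwise before the functions are known to be distinct.\<close>

definition indep_family :: "'s set \<Rightarrow> ('s \<Rightarrow> 'a \<Rightarrow> real) \<Rightarrow> bool" where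
  "indep_family T u \<longleftrightarrow>
     (\<forall>c. (\<forall>x. (\<Sum>s\<in>T. c s * u s x) = 0) \<longrightarrow> (\<forall>s\<in>T. c s = 0))"

lemma indep_familyI:
  assumes "\<And>c s. (\<And>x. (\<Sum>s\<in>T. c s * u s x) = 0) \<Longrightarrow> s \<in> T \<Longrightarrow> c s = 0"
  shows "indep_family T u"
  using assms unfolding indep_family_def by blast

lemma indep_familyD:
  assumes "indep_family T u" "\<And>x. (\<Sum>s\<in>T. c s * u s x) = 0" "s \<in> T"
  shows "c s = 0"
  using assms unfolding indep_family_def by blast

lemma indep_family_inj:
  assumes "finite T" "indep_family T u"
  shows "inj_on u T"
proof (rule inj_onI, rule ccontr)
  fix s t assume st: "s \<in> T" "t \<in> T" "u s = u t" "s \<noteq> t"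
  define c where "c = (\<lambda>r. if r = s then 1 else if r = t then -1 else (0::real))"
  have "(\<Sum>r\<in>T. c r * u r x) = 0" for x
  proof -
    have "(\<Sum>r\<in>T. c r * u r x) = (\<Sum>r\<in>{s,t}. c r * u r x)"
      by (rule sum.mono_neutral_right) (use assms st in \<open>auto simp: c_def\<close>)
    also have "\<dots> = 0" using st by (simp add: c_def)
    finally show ?thesis .
  qed
  from indep_familyD[OF assms(2) this st(1)] show False by (simp add: c_def)
qed

lemma indep_family_independent:
  assumes "finite T" "indep_family T u"
  shows "fun_vs.independent (u ` T)"
proof
  assume "fun_vs.dependent (u ` T)"
  then obtain a where a: "\<exists>v\<in>u ` T. a v \<noteq> 0" "(\<Sum>v\<in>u ` T. fscale (a v) v) = 0"
    using assms(1) by (auto simp: fun_vs.dependent_finite)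
  have "(\<Sum>s\<in>T. fscale (a (u s)) (u s)) = 0"
    using a(2) by (simp add: sum.reindex[OF indep_family_inj[OF assms]])
  hence "(\<Sum>s\<in>T. a (u s) * u s x) = 0" for x
    by (simp add: sum_fscale fun_eq_iff)
  from indep_familyD[OF assms(2) this] a(1) show False by auto
qed

lemma independent_imp_indep_family:
  assumes "finite B" "fun_vs.independent B"
  shows "indep_family B (\<lambda>b. b)"
proof (rule indep_familyI)
  fix c s assume c: "\<And>x. (\<Sum>b\<in>B. c b * b x) = 0" and s: "s \<in> B"
  have "(\<Sum>b\<in>B. fscale (c b) b) = 0"
    using c by (simp add: sum_fscale fun_eq_iff)
  with assms s show "c s = 0" by (auto simp: fun_vs.dependent_finite)
qed

lemma span_familyI:
  assumes "\<And>x. f x = (\<Sum>s\<in>T. c s * u s x)"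
  shows "f \<in> fun_vs.span (u ` T)"
proof -
  have "f = (\<Sum>s\<in>T. fscale (c s) (u s))"
    using assms by (simp add: sum_fscale fun_eq_iff)
  thus ?thesis
    by (simp add: fun_vs.span_sum fun_vs.span_scale fun_vs.span_base)
qed

lemma span_familyE:
  assumes "f \<in> fun_vs.span (u ` T)" "finite T" "inj_on u T"
  obtains c where "\<And>x. f x = (\<Sum>s\<in>T. c s * u s x)"
proof -
  obtain a where "f = (\<Sum>v\<in>u ` T. fscale (a v) v)"
    using assms by (auto simp: fun_vs.span_finite)
  also have "\<dots> = (\<lambda>x. \<Sum>s\<in>T. a (u s) * u s x)"
    by (simp add: sum.reindex[OF assms(3)] sum_fscale)
  finally show ?thesis using that[of "\<lambda>s. a (u s)"] by simp
qed

lemma indep_family_card_le: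
  assumes "finite T" "indep_family T u" "finite H" "u ` T \<subseteq> fun_vs.span H"
  shows "card T \<le> card H"
  using fun_vs.independent_span_bound[OF assms(3) indep_family_independent[OF assms(1,2)] assms(4)]
  by (simp add: card_image[OF indep_family_inj[OF assms(1,2)]])

text \<open>Spanning by counting: an \<open>f\<close> outside the span would extend the family to an
  independent set in the span of \<open>H\<close> with more than \<open>card H\<close>
  elements.\<close>

lemma indep_family_spans:
  assumes "finite T" "indep_family T u" "finite H" "u ` T \<subseteq> fun_vs.span H"
    and "card H \<le> card T" "f \<in> fun_vs.span H"
  shows "f \<in> fun_vs.span (u ` T)"
proof (rule ccontr)
  assume f: "f \<notin> fun_vs.span (u ` T)"
  have "fun_vs.independent (insert f (u ` T))"
    using f indep_family_independent[OF assms(1,2)] by (intro fun_vs.independent_insertI)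
  from fun_vs.independent_span_bound[OF assms(3) this]
  have "card (insert f (u ` T)) \<le> card H" using assms by auto
  moreover have "f \<notin> u ` T" using f fun_vs.span_base by blast
  ultimately show False
    using assms by (simp add: card_image[OF indep_family_inj[OF assms(1,2)]])
qed

text \<open>The dimension is squeezed between an independent family inside \<open>V\<close> and an
  equally small spanning set \<open>H\<close> of some space containing \<open>V\<close>.\<close>

lemma dim_eq_card_family:
  assumes "finite T" "indep_family T u" "u ` T \<subseteq> V"
    and "finite H" "V \<subseteq> fun_vs.span H" "card H \<le> card T"
  shows "fun_vs.dim V = card T"
proof (rule fun_vs.dim_unique)
  show "u ` T \<subseteq> V" by fact
  show "fun_vs.independent (u ` T)" "card (u ` T) = card T"
    using assms(1,2) by (simp_all add: indep_family_independent card_image indep_family_inj)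
  show "V \<subseteq> fun_vs.span (u ` T)"
    using indep_family_spans[OF assms(1,2,4) _ assms(6)] assms(3,5) by blast
qed

section \<open>The sl2-action on functions on the grid\<close>

locale rect_grid =
  fixes n :: nat and k :: "nat \<Rightarrow> nat"
begin

definition max_wt :: nat where
  "max_wt = (\<Sum>i\<in>{1..n}. k i - 1)"

definition layer_funs :: "nat \<Rightarrow> ((nat \<Rightarrow> nat) \<Rightarrow> real) set" where
  "layer_funs j = {f. \<forall>x. x \<notin> layers n k {j} \<longrightarrow> f x = 0}"

text \<open>
  The raising and lowering operators of the tensor product of the simple sl2-modules of
  dimensions \<open>k i\<close>. The coefficients \<open>x i\<close> and \<open>k i - 1 - x i\<close> vanish exactly where the
  shifted point would leave the grid.
\<close>

definition up :: "((nat \<Rightarrow> nat) \<Rightarrow> real) \<Rightarrow> (nat \<Rightarrow> nat) \<Rightarrow> real" where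
  "up f x = (if x \<in> grid n k then \<Sum>i\<in>{1..n}. real (x i) * f (x(i := x i - 1)) else 0)"

definition down :: "((nat \<Rightarrow> nat) \<Rightarrow> real) \<Rightarrow> (nat \<Rightarrow> nat) \<Rightarrow> real" where
  "down f x =
     (if x \<in> grid n k then \<Sum>i\<in>{1..n}. real (k i - 1 - x i) * f (x(i := Suc (x i))) else 0)"

lemma finite_grid: "finite (grid n k)"
  unfolding grid_def by (intro finite_PiE) auto

lemma finite_layers: "finite (layers n k F)"
  unfolding layers_def using finite_grid by auto

lemma grid_le: "x \<in> grid n k \<Longrightarrow> i \<in> {1..n} \<Longrightarrow> x i \<le> k i - 1"
  unfolding grid_def PiE_def Pi_def by auto

lemma grid_upd: "x \<in> grid n k \<Longrightarrow> i \<in> {1..n} \<Longrightarrow> v \<le> k i - 1 \<Longrightarrow> x(i := v) \<in> grid n k"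
  unfolding grid_def by (auto simp: PiE_def Pi_def extensional_def)

lemma wt_le: "x \<in> grid n k \<Longrightarrow> wt n x \<le> max_wt"
  unfolding wt_def max_wt_def by (intro sum_mono grid_le)

lemma wt_upd: "i \<in> {1..n} \<Longrightarrow> wt n (x(i := v)) + x i = wt n x + v"
  unfolding wt_def
  using sum.remove[of "{1..n}" i x] sum.remove[of "{1..n}" i "x(i := v)"] sum.cong[of "{1..n} - {i}"]
  by simp

lemma in_layer: "x \<in> layers n k {j} \<longleftrightarrow> x \<in> grid n k \<and> wt n x = j"
  by (auto simp: layers_def)

lemma layer_funs_eq_0: "f \<in> layer_funs j \<Longrightarrow> x \<notin> grid n k \<or> wt n x \<noteq> j \<Longrightarrow> f x = 0"
  by (auto simp: layer_funs_def in_layer)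

lemma layer_funs_lincomb:
  "(\<And>s. s \<in> T \<Longrightarrow> u s \<in> layer_funs j) \<Longrightarrow> (\<lambda>x. \<Sum>s\<in>T. c s * u s x) \<in> layer_funs j"
  by (auto simp: layer_funs_def intro!: sum.neutral)

lemma up_lincomb: "up (\<lambda>x. \<Sum>s\<in>T. c s * u s x) = (\<lambda>x. \<Sum>s\<in>T. c s * up (u s) x)"
  unfolding up_def
  by (rule ext) (simp add: sum_distrib_left mult.left_commute sum.swap[of _ T])

lemma down_lincomb: "down (\<lambda>x. \<Sum>s\<in>T. c s * u s x) = (\<lambda>x. \<Sum>s\<in>T. c s * down (u s) x)"
  unfolding down_def
  by (rule ext) (simp add: sum_distrib_left mult.left_commute sum.swap[of _ T])

lemma up_pow_lincomb:
  "(up ^^ r) (\<lambda>x. \<Sum>s\<in>T. c s * u s x) = (\<lambda>x. \<Sum>s\<in>T. c s * (up ^^ r) (u s) x)"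
  by (induction r) (simp_all add: up_lincomb)

lemma up_layer:
  assumes "f \<in> layer_funs j"
  shows "up f \<in> layer_funs (Suc j)"
proof -
  have "up f x = 0" if "x \<in> grid n k" "wt n x \<noteq> Suc j" for x
  proof -
    have "real (x i) * f (x(i := x i - 1)) = 0" if "i \<in> {1..n}" for i
      using wt_upd[OF that, of x "x i - 1"] \<open>wt n x \<noteq> Suc j\<close>
      by (cases "x i = 0") (auto intro!: layer_funs_eq_0[OF assms])
    thus ?thesis unfolding up_def by (auto intro!: sum.neutral)
  qed
  thus ?thesis by (auto simp: layer_funs_def in_layer) (auto simp: up_def)
qed

lemma up_pow_layer: "f \<in> layer_funs j \<Longrightarrow> (up ^^ r) f \<in> layer_funs (j + r)"
  by (induction r) (auto intro: up_layer)

lemma down_eq_0: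
  assumes "f \<in> layer_funs j" "Suc (wt n x) \<noteq> j"
  shows "down f x = 0"
proof -
  have "f (x(i := Suc (x i))) = 0" if "i \<in> {1..n}" for i
    using wt_upd[OF that, of x "Suc (x i)"] assms
    by (auto intro!: layer_funs_eq_0[OF assms(1)])
  thus ?thesis unfolding down_def by (auto intro!: sum.neutral)
qed

lemma down_layer: "f \<in> layer_funs (Suc j) \<Longrightarrow> down f \<in> layer_funs j"
  using down_eq_0[of f "Suc j"] by (auto simp: layer_funs_def in_layer) (auto simp: down_def)

text \<open>Both compositions are double sums over pairs of coordinates. Shifts in different
  coordinates commute, so only the diagonal remains; there, with K = \<open>k i - 1\<close> and y =
  \<open>x i\<close>, the difference is (K - y)(y + 1) - y(K - y + 1) = K - 2y.\<close>

lemma commutator_pointwise: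
  assumes x: "x \<in> grid n k"
  shows "down (up f) x = up (down f) x + (real max_wt - 2 * real (wt n x)) * f x"
proof -
  let ?I = "{1..n}"
  have 1: "down (up f) x = (\<Sum>i\<in>?I. \<Sum>j\<in>?I. real (k i - 1 - x i) *
      (real ((x(i := Suc (x i))) j) *
        f ((x(i := Suc (x i)))(j := (x(i := Suc (x i))) j - 1))))"
  proof -
    have "real (k i - 1 - x i) * up f (x(i := Suc (x i))) = real (k i - 1 - x i) *
      (\<Sum>j\<in>?I. real ((x(i := Suc (x i))) j) * f ((x(i := Suc (x i)))(j := (x(i := Suc (x i))) j - 1)))"
      if "i \<in> ?I" for i
    \<comment> \<open>If \<open>x i = k i - 1\<close>, the shifted point leaves the grid and
      \<open>up f\<close> is cut off to 0 there, but the factor in front is 0 as well.\<close>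
    proof (cases "x i < k i - 1")
      case True
      hence "x(i := Suc (x i)) \<in> grid n k" by (intro grid_upd x that) auto
      thus ?thesis unfolding up_def by simp
    qed simp
    thus ?thesis using x unfolding down_def[of "up f"] by (simp add: sum_distrib_left)
  qed
  have 2: "up (down f) x = (\<Sum>j\<in>?I. \<Sum>i\<in>?I. real (x j) *
      (real (k i - 1 - (x(j := x j - 1)) i) *
        f ((x(j := x j - 1))(i := Suc ((x(j := x j - 1)) i)))))"
  proof -
    have "x(j := x j - 1) \<in> grid n k" if "j \<in> ?I" for j
      using grid_le[OF x that] by (intro grid_upd x that) auto
    thus ?thesis using x unfolding up_def down_def by (simp add: sum_distrib_left)
  qed
  have 3: "real (k i - 1 - x i) *
      (real ((x(i := Suc (x i))) j) *
        f ((x(i := Suc (x i)))(j := (x(i := Suc (x i))) j - 1))) =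
     real (x j) * (real (k i - 1 - (x(j := x j - 1)) i) *
        f ((x(j := x j - 1))(i := Suc ((x(j := x j - 1)) i)))) +
     (if i = j then (real (k i - 1) - 2 * real (x i)) * f x else 0)"
    if "i \<in> ?I" "j \<in> ?I" for i j
  proof (cases "i = j")
    case True
    show ?thesis
    proof (cases "x i = 0")
      case True
      hence "x(j := 0) = x" using \<open>i = j\<close> by (simp add: fun_upd_idem)
      with True \<open>i = j\<close> show ?thesis by simp
    next
      case False
      hence "(x(i := x i - 1))(i := Suc (x i - 1)) = x" by (auto simp: fun_eq_iff)
      with \<open>i = j\<close> False grid_le[OF x that(1)] show ?thesis
        by (simp add: of_nat_diff algebra_simps)
    qed
  next
    case False
    thus ?thesis by (simp add: fun_upd_twist)
  qed
  have "down (up f) x = (\<Sum>i\<in>?I. \<Sum>j\<in>?I. real (x j) *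
      (real (k i - 1 - (x(j := x j - 1)) i) *
        f ((x(j := x j - 1))(i := Suc ((x(j := x j - 1)) i)))) +
     (if i = j then (real (k i - 1) - 2 * real (x i)) * f x else 0))"
    unfolding 1 by (intro sum.cong refl 3)
  also have "\<dots> = up (down f) x + (\<Sum>i\<in>?I. (real (k i - 1) - 2 * real (x i)) * f x)"
    unfolding 2 sum.distrib by (subst sum.swap) simp
  also have "(\<Sum>i\<in>?I. (real (k i - 1) - 2 * real (x i)) * f x) =
      (real max_wt - 2 * real (wt n x)) * f x"
    unfolding max_wt_def wt_def
    by (simp add: sum_subtractf sum_distrib_left sum_distrib_right left_diff_distrib)
  finally show ?thesis .
qed

lemma commutator:
  assumes "f \<in> layer_funs j"
  shows "down (up f) x = up (down f) x + (real max_wt - 2 * real j) * f x"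
proof (cases "x \<in> grid n k")
  case True
  thus ?thesis using commutator_pointwise[OF True, of f] layer_funs_eq_0[OF assms, of x]
    by (cases "wt n x = j") auto
next
  case False
  thus ?thesis using layer_funs_eq_0[OF assms, of x] by (simp add: up_def down_def)
qed

section \<open>Lowest-weight vectors and the strings they generate\<close>

definition prim :: "nat \<Rightarrow> ((nat \<Rightarrow> nat) \<Rightarrow> real) set" where
  "prim m = {f \<in> layer_funs m. \<forall>x. down f x = 0}"

lemma prim_lincomb:
  "(\<And>s. s \<in> T \<Longrightarrow> u s \<in> prim m) \<Longrightarrow> (\<lambda>x. \<Sum>s\<in>T. c s * u s x) \<in> prim m"
  by (auto simp: prim_def down_lincomb intro!: layer_funs_lincomb sum.neutral)

lemma prim_up_pow_layer: "v \<in> prim m \<Longrightarrow> (up ^^ r) v \<in> layer_funs (m + r)"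
  by (rule up_pow_layer) (simp add: prim_def)

lemma prim_scale: "v \<in> prim m \<Longrightarrow> (\<lambda>x. a * v x) \<in> prim m"
  \<comment> \<open>A one-point index set turns closure under linear combinations into closure under
    scaling.\<close>
  using prim_lincomb[of "{()}" "\<lambda>_. v" m "\<lambda>_. a"] by simp

text \<open>Moving \<open>down\<close> through \<open>i + 1\<close> copies of \<open>up\<close>
  collects the weights \<open>max_wt - 2 * (m + r)\<close> for r = 0, ..., i, and their sum is the
  stated coefficient.\<close>

lemma down_string:
  assumes v: "v \<in> prim m"
  shows "down ((up ^^ Suc i) v) x =
    real (Suc i) * (real max_wt - 2 * real m - real i) * (up ^^ i) v x"
proof (induction i arbitrary: x)
  case 0
  have "down v = (\<lambda>_. 0)" using v by (auto simp: prim_def)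
  moreover have "up (\<lambda>_. 0) x = 0" by (simp add: up_def)
  ultimately show ?case using commutator[of v m x] v by (simp add: prim_def)
next
  case (Suc i)
  let ?a = "real (Suc i) * (real max_wt - 2 * real m - real i)"
  have "(up ^^ Suc i) v \<in> layer_funs (m + Suc i)" by (rule prim_up_pow_layer[OF v])
  from commutator[OF this, of x]
  have "down ((up ^^ Suc (Suc i)) v) x = up (down ((up ^^ Suc i) v)) x +
      (real max_wt - 2 * real (m + Suc i)) * (up ^^ Suc i) v x"
    by simp
  also have "down ((up ^^ Suc i) v) = (\<lambda>x. ?a * (up ^^ i) v x)"
    using Suc.IH by blast
  also have "up (\<lambda>x. ?a * (up ^^ i) v x) x = ?a * (up ^^ Suc i) v x"
    using up_lincomb[of "\<lambda>_. ?a" "\<lambda>_. (up ^^ i) v" "{()}"] by simp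
  finally show ?case by (simp add: algebra_simps)
qed

lemma up_pow_zero: "(up ^^ r) (\<lambda>_. 0) = (\<lambda>_. 0)"
  using up_pow_lincomb[of r "\<lambda>_. 0" _ "{}"] by simp

text \<open>Some power of \<open>up\<close> kills \<open>v\<close> because the layers above
  \<open>max_wt\<close> are empty. At the first such power the coefficient in
  \<open>down_string\<close> must vanish, which for \<open>v\<close> nonzero happens only at power
  \<open>max_wt - 2 * m + 1\<close>.\<close>

lemma string_end:
  assumes v: "v \<in> prim m" and i: "max_wt < i + 2 * m"
  shows "(up ^^ i) v = (\<lambda>_. 0)"
proof (cases "v = (\<lambda>_. 0)")
  case True
  thus ?thesis using up_pow_zero by simp
next
  case False
  define P where "P = (\<lambda>i. (up ^^ i) v = (\<lambda>_. 0))"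
  define i0 where "i0 = (LEAST i. P i)"
  have "P (Suc max_wt)"
  proof -
    have "(up ^^ Suc max_wt) v \<in> layer_funs (m + Suc max_wt)"
      by (rule prim_up_pow_layer[OF v])
    from layer_funs_eq_0[OF this] have "(up ^^ Suc max_wt) v x = 0" for x
      using wt_le[of x] by fastforce
    thus ?thesis by (auto simp: P_def)
  qed
  hence i0: "P i0" unfolding i0_def by (rule LeastI)
  have "i0 \<noteq> 0"
  proof
    assume "i0 = 0"
    with i0 False show False by (simp add: P_def)
  qed
  then obtain i1 where i1: "i0 = Suc i1" by (cases i0) auto
  have "\<not> P i1" using not_less_Least[of i1 P] i1 by (simp add: i0_def)
  then obtain x where x: "(up ^^ i1) v x \<noteq> 0" by (auto simp: P_def)
  have "down ((up ^^ Suc i1) v) x = 0" using i0 unfolding P_def i1 by (simp add: down_def)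
  with down_string[OF v, of i1 x] x have "real max_wt - 2 * real m - real i1 = 0" by simp
  hence "i0 \<le> i" using i i1 by linarith
  then obtain r where r: "i = r + i0" by (metis le_add_diff_inverse2)
  show ?thesis unfolding r funpow_add using i0 up_pow_zero by (simp add: P_def)
qed

text \<open>By induction \<open>down f\<close> decomposes into strings. Lifting each term one layer
  and dividing by its coefficient in \<open>down_string\<close> gives \<open>g\<close> with
  \<open>down g = down f\<close>, and \<open>f - g\<close> is a lowest-weight vector starting new
  strings.\<close>

lemma string_span:
  assumes "f \<in> layer_funs j" "2 * j \<le> max_wt"
  shows "\<exists>v. (\<forall>m\<le>j. v m \<in> prim m) \<and> (\<forall>x. f x = (\<Sum>m\<le>j. (up ^^ (j - m)) (v m) x))"
  using assms
proof (induction j arbitrary: f)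
  case 0
  have "f \<in> prim 0" using 0 down_eq_0[of f 0] by (auto simp: prim_def)
  thus ?case by (intro exI[of _ "\<lambda>_. f"]) auto
next
  case (Suc j)
  from Suc.IH[OF down_layer[OF Suc.prems(1)]] Suc.prems(2) obtain v where
    v: "\<And>m. m \<le> j \<Longrightarrow> v m \<in> prim m" "\<And>x. down f x = (\<Sum>m\<le>j. (up ^^ (j - m)) (v m) x)"
    by auto
  define a where "a = (\<lambda>m. real (Suc (j - m)) * (real max_wt - 2 * real m - real (j - m)))"
  \<comment> \<open>The second factor is \<open>max_wt - m - j\<close>, positive because
    \<open>m \<le> j\<close> and \<open>2 * Suc j \<le> max_wt\<close>.\<close>
  have a: "a m \<noteq> 0" if "m \<le> j" for m
    using that Suc.prems(2) by (auto simp: a_def of_nat_diff)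
  define v' where "v' = (\<lambda>m x. (1 / a m) * v m x)"
  \<comment> \<open>The factor 1 gives \<open>g\<close> the shape of the linear combination
    lemmas.\<close>
  define g where "g = (\<lambda>x. \<Sum>m\<le>j. 1 * (up ^^ (Suc j - m)) (v' m) x)"
  have v': "v' m \<in> prim m" if "m \<le> j" for m
    unfolding v'_def by (intro prim_scale v that)
  have pow: "(up ^^ r) (v' m) x = (1 / a m) * (up ^^ r) (v m) x" for r m x
    unfolding v'_def using up_pow_lincomb[of r "\<lambda>_. 1 / a m" "\<lambda>_. v m" "{()}"] by simp
  have g: "g \<in> layer_funs (Suc j)" unfolding g_def
  proof (rule layer_funs_lincomb)
    fix m assume "m \<in> {..j}"
    with v' have "(up ^^ (Suc j - m)) (v' m) \<in> layer_funs (m + (Suc j - m))"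
      by (intro up_pow_layer) (auto simp: prim_def)
    thus "(up ^^ (Suc j - m)) (v' m) \<in> layer_funs (Suc j)" using \<open>m \<in> {..j}\<close> by simp
  qed
  have "down g x = down f x" for x
  proof -
    have "down g x = (\<Sum>m\<le>j. down ((up ^^ Suc (j - m)) (v' m)) x)"
      unfolding g_def down_lincomb by (auto intro!: sum.cong simp: Suc_diff_le)
    also have "\<dots> = (\<Sum>m\<le>j. (up ^^ (j - m)) (v m) x)"
    proof (rule sum.cong[OF refl])
      fix m assume m: "m \<in> {..j}"
      have "down ((up ^^ Suc (j - m)) (v' m)) x = a m * (up ^^ (j - m)) (v' m) x"
        using down_string[OF v'[of m]] m unfolding a_def by auto
      also have "\<dots> = (up ^^ (j - m)) (v m) x" unfolding pow using a[of m] m by simp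
      finally show "down ((up ^^ Suc (j - m)) (v' m)) x = (up ^^ (j - m)) (v m) x" .
    qed
    finally show ?thesis by (simp add: v)
  qed
  note dg = this
  define h where "h = (\<lambda>x. f x - g x)"
  have "h \<in> prim (Suc j)"
  proof -
    have "down h x = down f x - down g x" for x
      unfolding h_def down_def by (simp add: right_diff_distrib sum_subtractf)
    hence "down h x = 0" for x using dg by simp
    thus ?thesis using g Suc.prems by (auto simp: prim_def h_def layer_funs_def)
  qed
  show ?case
  proof (intro exI conjI allI impI)
    fix m assume "m \<le> Suc j"
    thus "(if m = Suc j then h else v' m) \<in> prim m"
      using \<open>h \<in> prim (Suc j)\<close> v' by auto
  next
    fix x
    have "(\<Sum>m\<le>Suc j. (up ^^ (Suc j - m)) (if m = Suc j then h else v' m) x) = g x + h x"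
      unfolding g_def by (auto intro!: sum.cong)
    thus "f x = (\<Sum>m\<le>Suc j. (up ^^ (Suc j - m)) (if m = Suc j then h else v' m) x)"
      by (simp add: h_def)
  qed
qed

text \<open>Applying the lowering operator reduces a relation in layer \<open>j + 1\<close> to one in layer \<open>j\<close>.\<close>

lemma string_indep:
  assumes "\<And>m. m \<le> j \<Longrightarrow> m + j \<le> max_wt \<Longrightarrow> v m \<in> prim m"
    and "\<And>x. (\<Sum>m | m \<le> j \<and> m + j \<le> max_wt. (up ^^ (j - m)) (v m) x) = 0"
    and "m \<le> j" "m + j \<le> max_wt"
  shows "v m = (\<lambda>_. 0)"
  using assms
proof (induction j arbitrary: v m)
  case 0
  have "{m. m \<le> 0 \<and> m + 0 \<le> max_wt} = {0}" by auto
  with 0 show ?case by (simp add: fun_eq_iff)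
next
  case (Suc j)
  define M where "M = {m. m \<le> Suc j \<and> m + Suc j \<le> max_wt}"
  \<comment> \<open>Lowering kills the term \<open>m = Suc j\<close>; for the remaining indices
    \<open>max_wt - m - j\<close> is positive, so no other coefficient vanishes.\<close>
  define M' where "M' = {m. m \<le> j \<and> m + Suc j \<le> max_wt}"
  define a where "a = (\<lambda>m. real (Suc (j - m)) * (real max_wt - 2 * real m - real (j - m)))"
  have fin: "finite M" "finite M'" unfolding M_def M'_def by auto
  have vp: "v m \<in> prim m" if "m \<in> M" for m using Suc.prems(1) that by (auto simp: M_def)
  have a: "a m \<noteq> 0" if "m \<in> M'" for m
    using that by (auto simp: a_def M'_def of_nat_diff)
  \<comment> \<open>The relation in layer \<open>j\<close> may also involve an index with
    \<open>m + j = max_wt\<close>, whose string ends there; it receives the zero vector.\<close>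
  define v' where "v' = (\<lambda>m x. (if m \<in> M' then a m else 0) * v m x)"
  have pow: "(up ^^ r) (v' m) x = (if m \<in> M' then a m else 0) * (up ^^ r) (v m) x" for r m x
    unfolding v'_def
    using up_pow_lincomb[of r "\<lambda>_. if m \<in> M' then a m else 0" "\<lambda>_. v m" "{()}"] by simp
  have "v' m = (\<lambda>_. 0)" if "m \<in> M'" for m
  proof (rule Suc.IH)
    fix m assume m: "m \<le> j" "m + j \<le> max_wt"
    show "v' m \<in> prim m"
    proof (cases "m \<in> M'")
      case True
      thus ?thesis unfolding v'_def
        using Suc.prems(1)[of m] by (intro prim_scale) (auto simp: M'_def)
    next
      case False
      thus ?thesis by (simp add: v'_def prim_def layer_funs_def down_def)
    qed
  next
    fix x
    have "0 = down (\<lambda>x. \<Sum>m\<in>M. 1 * (up ^^ (Suc j - m)) (v m) x) x"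
      using Suc.prems(2) unfolding M_def by (simp add: down_def)
    also have "\<dots> = (\<Sum>m\<in>M. down ((up ^^ (Suc j - m)) (v m)) x)"
      unfolding down_lincomb by simp
    also have "\<dots> = (\<Sum>m\<in>M'. down ((up ^^ (Suc j - m)) (v m)) x)"
    proof (rule sum.mono_neutral_right[OF fin(1)])
      show "M' \<subseteq> M" by (auto simp: M_def M'_def)
      have "m = Suc j" if "m \<in> M - M'" for m using that by (auto simp: M_def M'_def)
      thus "\<forall>m\<in>M - M'. down ((up ^^ (Suc j - m)) (v m)) x = 0"
        using vp by (fastforce simp: prim_def)
    qed
    also have "\<dots> = (\<Sum>m\<in>M'. a m * (up ^^ (j - m)) (v m) x)"
    proof (rule sum.cong[OF refl])
      fix m assume "m \<in> M'"
      hence "m \<in> M" "Suc j - m = Suc (j - m)" by (auto simp: M_def M'_def)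
      thus "down ((up ^^ (Suc j - m)) (v m)) x = a m * (up ^^ (j - m)) (v m) x"
        using down_string[OF vp[OF \<open>m \<in> M\<close>], of "j - m" x] by (simp add: a_def)
    qed
    also have "\<dots> = (\<Sum>m\<in>M'. (up ^^ (j - m)) (v' m) x)"
      by (intro sum.cong) (auto simp: pow)
    also have "\<dots> = (\<Sum>m | m \<le> j \<and> m + j \<le> max_wt. (up ^^ (j - m)) (v' m) x)"
      by (rule sum.mono_neutral_left) (auto simp: M'_def pow)
    finally show "(\<Sum>m | m \<le> j \<and> m + j \<le> max_wt. (up ^^ (j - m)) (v' m) x) = 0" by simp
  qed (use that in \<open>auto simp: M'_def\<close>)
  hence z: "v m = (\<lambda>_. 0)" if "m \<in> M'" for m
    using a[OF that] that by (auto simp: v'_def fun_eq_iff)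
  show ?case
  proof (cases "m \<in> M'")
    case True
    thus ?thesis using z by blast
  next
    case False
    hence m: "m = Suc j" "m \<in> M" using Suc.prems(3,4) by (auto simp: M_def M'_def)
    have "v m x = 0" for x
    proof -
      have "0 = (\<Sum>m\<in>M. (up ^^ (Suc j - m)) (v m) x)"
        using Suc.prems(2)[of x] by (simp add: M_def)
      also have "\<dots> = (\<Sum>m\<in>{Suc j}. (up ^^ (Suc j - m)) (v m) x)"
      proof (rule sum.mono_neutral_right[OF fin(1)])
        show "{Suc j} \<subseteq> M" using m by simp
        have "m \<in> M'" if "m \<in> M - {Suc j}" for m using that by (auto simp: M_def M'_def)
        thus "\<forall>m\<in>M - {Suc j}. (up ^^ (Suc j - m)) (v m) x = 0"
          using z up_pow_zero by auto
      qed
      finally show ?thesis using m by simp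
    qed
    thus ?thesis by auto
  qed
qed

section \<open>Decomposition into strings\<close>

definition delta :: "(nat \<Rightarrow> nat) \<Rightarrow> (nat \<Rightarrow> nat) \<Rightarrow> real" where
  "delta a x = (if x = a then 1 else 0)"

lemma delta_layer: "a \<in> layers n k {j} \<Longrightarrow> delta a \<in> layer_funs j"
  by (auto simp: layer_funs_def delta_def)

lemma layer_funs_delta:
  assumes "f \<in> layer_funs j"
  shows "f x = (\<Sum>a\<in>layers n k {j}. f a * delta a x)"
proof -
  have "(\<Sum>a\<in>layers n k {j}. f a * delta a x) =
      (\<Sum>a\<in>layers n k {j}. if a = x then f x else 0)"
    by (intro sum.cong) (auto simp: delta_def)
  thus ?thesis using assms by (simp add: finite_layers layer_funs_def)
qed

lemma indep_family_delta: "indep_family (layers n k F) delta"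
proof (rule indep_familyI)
  fix c a assume c: "\<And>x. (\<Sum>a\<in>layers n k F. c a * delta a x) = 0" and a: "a \<in> layers n k F"
  have "(\<Sum>b\<in>layers n k F. c b * delta b a) = (\<Sum>b\<in>layers n k F. if b = a then c a else 0)"
    by (intro sum.cong) (auto simp: delta_def)
  with c[of a] a show "c a = 0" by (simp add: finite_layers)
qed

lemma layer_funs_span_delta: "layer_funs j \<subseteq> fun_vs.span (delta ` layers n k {j})"
proof
  fix f assume f: "f \<in> layer_funs j"
  show "f \<in> fun_vs.span (delta ` layers n k {j})"
    by (rule span_familyI[where c = f], rule layer_funs_delta[OF f])
qed

text \<open>Finiteness comes from the point masses of layer \<open>m\<close>, which span all
  functions on that layer.\<close>

lemma prim_basis_exists:
  "\<exists>B. finite B \<and> B \<subseteq> prim m \<and> fun_vs.independent B \<and> prim m \<subseteq> fun_vs.span B"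
proof -
  obtain B where B: "B \<subseteq> prim m" "fun_vs.independent B" "prim m \<subseteq> fun_vs.span B"
    by (rule fun_vs.basis_exists)
  have "B \<subseteq> fun_vs.span (delta ` layers n k {m})"
    using B(1) layer_funs_span_delta[of m] by (auto simp: prim_def)
  hence "finite B"
    using fun_vs.independent_span_bound[OF finite_imageI[OF finite_layers] B(2)] by simp
  with B show ?thesis by (intro exI[of _ B]) simp
qed

definition prim_basis :: "nat \<Rightarrow> ((nat \<Rightarrow> nat) \<Rightarrow> real) set" where
  "prim_basis m =
     (SOME B. finite B \<and> B \<subseteq> prim m \<and> fun_vs.independent B \<and> prim m \<subseteq> fun_vs.span B)"

lemma prim_basis:
  "finite (prim_basis m)" "prim_basis m \<subseteq> prim m"
  "fun_vs.independent (prim_basis m)" "prim m \<subseteq> fun_vs.span (prim_basis m)"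
  using someI_ex[OF prim_basis_exists[of m]] unfolding prim_basis_def[symmetric] by simp_all

lemma prim_basis_repr:
  assumes "v \<in> prim m"
  obtains c where "v = (\<lambda>x. \<Sum>b\<in>prim_basis m. c b * b x)"
proof (rule span_familyE[of v "\<lambda>b. b" "prim_basis m"])
  show "v \<in> fun_vs.span ((\<lambda>b. b) ` prim_basis m)" using assms prim_basis(4) by auto
  fix c assume "\<And>x. v x = (\<Sum>b\<in>prim_basis m. c b * b x)"
  hence "v = (\<lambda>x. \<Sum>b\<in>prim_basis m. c b * b x)" by (rule ext)
  thus thesis by (rule that)
qed (simp_all add: prim_basis(1))

text \<open>
  A string is represented by its first vector, paired with the layer \<open>m\<close> containing that vector;
  it meets the layers \<open>m, \<dots>, max_wt - m\<close>. The normalization of \<open>string_vec\<close> makes the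
  exponential act by binomial coefficients.
\<close>

definition strings :: "nat \<Rightarrow> (nat \<times> ((nat \<Rightarrow> nat) \<Rightarrow> real)) set" where
  "strings j = Sigma {m. m \<le> j \<and> m + j \<le> max_wt} prim_basis"

definition string_vec :: "nat \<Rightarrow> nat \<times> ((nat \<Rightarrow> nat) \<Rightarrow> real) \<Rightarrow> (nat \<Rightarrow> nat) \<Rightarrow> real" where
  "string_vec j s = (\<lambda>x. (up ^^ (j - fst s)) (snd s) x / fact (j - fst s))"

lemma strings_iff:
  "s \<in> strings j \<longleftrightarrow> snd s \<in> prim_basis (fst s) \<and> fst s \<le> j \<and> fst s + j \<le> max_wt"
  by (cases s) (auto simp: strings_def)

lemma finite_strings: "finite (strings j)"
  unfolding strings_def by (intro finite_SigmaI) (auto simp: prim_basis)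

lemma strings_prim: "s \<in> strings j \<Longrightarrow> snd s \<in> prim (fst s)"
  using prim_basis(2) by (auto simp: strings_iff)

lemma string_vec_layer:
  assumes "s \<in> strings j"
  shows "string_vec j s \<in> layer_funs j"
  using prim_up_pow_layer[OF strings_prim[OF assms], of "j - fst s"] assms
  by (auto simp: string_vec_def layer_funs_def strings_iff)

lemma sum_strings:
  "(\<Sum>s\<in>strings j. f s) =
     (\<Sum>m | m \<le> j \<and> m + j \<le> max_wt. \<Sum>b\<in>prim_basis m. f (m, b))"
  unfolding strings_def by (subst sum.Sigma) (auto simp: prim_basis)

text \<open>Grouping a relation by starting layer gives one lowest-weight vector for each
  \<open>m\<close>. These vanish by \<open>string_indep\<close>, and then independence of
  \<open>prim_basis m\<close> applies.\<close>

lemma strings_indep: "indep_family (strings j) (string_vec j)"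
proof (rule indep_familyI)
  fix c s assume c: "\<And>x. (\<Sum>s\<in>strings j. c s * string_vec j s x) = 0" and s: "s \<in> strings j"
  define v where "v = (\<lambda>m x. \<Sum>b\<in>prim_basis m. (c (m, b) / fact (j - m)) * b x)"
  obtain m b where mb: "s = (m, b)" by (cases s)
  have "v m = (\<lambda>_. 0)"
  proof (rule string_indep)
    show "v m \<in> prim m" for m
      unfolding v_def using prim_basis(2)[of m] by (intro prim_lincomb) auto
    show "m \<le> j" "m + j \<le> max_wt" using s mb by (auto simp: strings_iff)
    show "(\<Sum>m | m \<le> j \<and> m + j \<le> max_wt. (up ^^ (j - m)) (v m) x) = 0" for x
      using c[of x] unfolding sum_strings v_def up_pow_lincomb by (simp add: string_vec_def)
  qed
  hence "(\<Sum>b\<in>prim_basis m. (c (m, b) / fact (j - m)) * b x) = 0" for x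
    unfolding v_def by (rule fun_cong)
  from indep_familyD[OF independent_imp_indep_family[OF prim_basis(1,3)] this, of b]
  show "c s = 0" using s by (auto simp: mb strings_iff)
qed

text \<open>In the lower half \<open>m \<le> j\<close> already implies
  \<open>m + j \<le> max_wt\<close>, so every term provided by \<open>string_span\<close> belongs to
  \<open>strings j\<close>.\<close>

lemma strings_span_low:
  assumes "f \<in> layer_funs j" "2 * j \<le> max_wt"
  shows "f \<in> fun_vs.span (string_vec j ` strings j)"
proof -
  obtain v where v: "\<And>m. m \<le> j \<Longrightarrow> v m \<in> prim m"
      "\<And>x. f x = (\<Sum>m\<le>j. (up ^^ (j - m)) (v m) x)"
    using string_span[OF assms] by blast
  have "\<exists>c. v m = (\<lambda>x. \<Sum>b\<in>prim_basis m. c b * b x)" if "m \<le> j" for m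
    using prim_basis_repr[OF v(1)[OF that]] by blast
  then obtain c where c: "\<And>m. m \<le> j \<Longrightarrow> v m = (\<lambda>x. \<Sum>b\<in>prim_basis m. c m b * b x)"
    by metis
  have M: "{m. m \<le> j \<and> m + j \<le> max_wt} = {..j}" using assms(2) by auto
  show ?thesis
  proof (rule span_familyI)
    fix x
    have "f x = (\<Sum>m\<le>j. \<Sum>b\<in>prim_basis m. c m b * (up ^^ (j - m)) b x)"
      unfolding v(2) by (intro sum.cong refl) (simp add: c up_pow_lincomb)
    thus "f x = (\<Sum>s\<in>strings j. (c (fst s) (snd s) * fact (j - fst s)) * string_vec j s x)"
      unfolding sum_strings M by (simp add: string_vec_def)
  qed
qed

section \<open>Counting the strings through a layer\<close>

text \<open>The reflection of every coordinate, \<open>x i\<close> to \<open>k i - 1 - x i\<close>,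
  is an involution exchanging the two layers; \<open>restrict\<close> keeps its values
  extensional.\<close>

lemma layer_size_sym:
  assumes "j \<le> max_wt"
  shows "layer_size n k (max_wt - j) = layer_size n k j"
proof -
  define r where "r = (\<lambda>x. restrict (\<lambda>i. k i - 1 - x i) {1..n})"
  have r: "r x \<in> layers n k {max_wt - j}" "r (r x) = x"
    if "x \<in> layers n k {j}" for x j
  proof -
    have x: "x \<in> grid n k" "wt n x = j" using that by (auto simp: in_layer)
    have "wt n (r x) = (\<Sum>i\<in>{1..n}. k i - 1 - x i)" by (simp add: wt_def r_def)
    also have "\<dots> = max_wt - j"
      unfolding max_wt_def x(2)[symmetric] wt_def
      by (rule sum_subtractf_nat) (use grid_le[OF x(1)] in auto)
    finally show "r x \<in> layers n k {max_wt - j}" by (auto simp: in_layer grid_def r_def)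
    have "x i = undefined" if "i \<notin> {1..n}" for i
      using x(1) that by (auto simp: grid_def PiE_def extensional_def)
    hence "r (r x) i = x i" for i using grid_le[OF x(1), of i] by (cases "i \<in> {1..n}") (auto simp: r_def)
    thus "r (r x) = x" by (rule ext)
  qed
  have "bij_betw r (layers n k {j}) (layers n k {max_wt - j})"
    by (rule bij_betw_byWitness[where f' = r])
       (use r[of _ j] r[of _ "max_wt - j"] assms in auto)
  thus ?thesis unfolding layer_size_def by (simp add: bij_betw_same_card)
qed

lemma card_delta: "card (delta ` layers n k {j}) = layer_size n k j"
  unfolding layer_size_def
  by (rule card_image[OF indep_family_inj[OF finite_layers indep_family_delta]])

lemma string_vec_span_delta: "string_vec j ` strings j \<subseteq> fun_vs.span (delta ` layers n k {j})"
  using layer_funs_span_delta string_vec_layer by blast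

text \<open>In the lower half the string vectors and the point masses are both bases, so their
  numbers agree. The upper half follows by symmetry, as both sides are invariant under
  \<open>j\<close> to \<open>max_wt - j\<close>.\<close>

lemma card_strings:
  assumes "j \<le> max_wt"
  shows "card (strings j) = layer_size n k j"
proof -
  have low: "card (strings j) = layer_size n k j" if "2 * j \<le> max_wt" for j
  proof (rule antisym)
    show "card (strings j) \<le> layer_size n k j"
      using indep_family_card_le[OF finite_strings strings_indep _ string_vec_span_delta, of j]
      by (simp add: finite_layers card_delta)
    have "delta ` layers n k {j} \<subseteq> fun_vs.span (string_vec j ` strings j)"
      using strings_span_low[OF delta_layer that] by blast
    from indep_family_card_le[OF finite_layers indep_family_delta _ this]
    show "layer_size n k j \<le> card (strings j)"
      by (simp add: finite_strings layer_size_def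
          card_image[OF indep_family_inj[OF finite_strings strings_indep]])
  qed
  show ?thesis
  proof (cases "2 * j \<le> max_wt")
    case False
    have "strings j = strings (max_wt - j)"
      using assms by (auto simp: strings_def)
    with low[of "max_wt - j"] layer_size_sym[OF assms] False show ?thesis by simp
  qed (rule low)
qed

lemma strings_span:
  assumes "f \<in> layer_funs j" "j \<le> max_wt"
  shows "f \<in> fun_vs.span (string_vec j ` strings j)"
proof (rule indep_family_spans[OF finite_strings strings_indep])
  show "finite (delta ` layers n k {j})" by (simp add: finite_layers)
  show "string_vec j ` strings j \<subseteq> fun_vs.span (delta ` layers n k {j})" by (rule string_vec_span_delta)
  show "card (delta ` layers n k {j}) \<le> card (strings j)"
    by (simp add: card_delta card_strings[OF assms(2)])
  show "f \<in> fun_vs.span (delta ` layers n k {j})" using layer_funs_span_delta assms(1) by blast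
qed

section \<open>The exponential of the raising operator\<close>

text \<open>As a function of \<open>x\<close> this is a polynomial of total degree
  \<open>wt n a\<close>.\<close>

definition binprod :: "(nat \<Rightarrow> nat) \<Rightarrow> (nat \<Rightarrow> nat) \<Rightarrow> real" where
  "binprod a x = (\<Prod>i\<in>{1..n}. real (x i choose a i))"

text \<open>
  By \<open>up_pow_eq_exp_up\<close> below this is the exponential of the raising operator; on point masses
  it yields the products of binomial coefficients, which span the polynomial functions.
\<close>

definition exp_up :: "((nat \<Rightarrow> nat) \<Rightarrow> real) \<Rightarrow> (nat \<Rightarrow> nat) \<Rightarrow> real" where
  "exp_up v x = (\<Sum>a\<in>grid n k. v a * binprod a x)"

lemma exp_up_lincomb: "exp_up (\<lambda>x. \<Sum>s\<in>T. c s * u s x) = (\<lambda>x. \<Sum>s\<in>T. c s * exp_up (u s) x)"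
proof
  fix x
  have "exp_up (\<lambda>x. \<Sum>s\<in>T. c s * u s x) x = (\<Sum>a\<in>grid n k. \<Sum>s\<in>T. c s * (u s a * binprod a x))"
    unfolding exp_up_def by (simp add: sum_distrib_right mult.assoc)
  also have "\<dots> = (\<Sum>s\<in>T. \<Sum>a\<in>grid n k. c s * (u s a * binprod a x))"
    by (rule sum.swap)
  finally show "exp_up (\<lambda>x. \<Sum>s\<in>T. c s * u s x) x = (\<Sum>s\<in>T. c s * exp_up (u s) x)"
    unfolding exp_up_def by (simp add: sum_distrib_left)
qed

lemma exp_up_delta:
  assumes "a \<in> grid n k"
  shows "exp_up (delta a) = binprod a"
proof
  fix x
  have "exp_up (delta a) x = (\<Sum>b\<in>grid n k. if b = a then binprod a x else 0)"
    unfolding exp_up_def by (intro sum.cong) (auto simp: delta_def)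
  thus "exp_up (delta a) x = binprod a x" using assms by (simp add: finite_grid)
qed

text \<open>A nonzero value forces \<open>a \<le> x\<close> in every coordinate, and the weight
  bound then forces equality. This makes the exponential unitriangular with respect to the
  layers.\<close>

lemma binprod_eq_delta:
  assumes "a \<in> grid n k" "x \<in> grid n k" "wt n x \<le> wt n a"
  shows "binprod a x = delta a x"
proof (cases "\<exists>i\<in>{1..n}. x i < a i")
  case True
  then obtain i where i: "i \<in> {1..n}" "x i < a i" by blast
  hence "binprod a x = 0" unfolding binprod_def by (intro prod_zero) auto
  moreover have "x \<noteq> a" using i by auto
  ultimately show ?thesis by (simp add: delta_def)
next
  case False
  hence le: "a i \<le> x i" if "i \<in> {1..n}" for i using that by force
  have "wt n x = wt n a" using assms(3) sum_mono[of "{1..n}" a x] le by (auto simp: wt_def)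
  hence "a i = x i" if "i \<in> {1..n}" for i
    using sum_mono_inv[of a "{1..n}" x i] le that by (auto simp: wt_def)
  moreover have "a i = x i" if "i \<notin> {1..n}" for i
    using assms that by (auto simp: grid_def PiE_def extensional_def)
  ultimately have "x = a" by (metis ext)
  thus ?thesis by (simp add: delta_def binprod_def)
qed

lemma exp_up_low:
  assumes "v \<in> layer_funs m" "x \<in> grid n k" "wt n x \<le> m"
  shows "exp_up v x = v x"
proof -
  have "exp_up v x = (\<Sum>a\<in>grid n k. if a = x then v x else 0)"
    unfolding exp_up_def
  proof (intro sum.cong refl)
    fix a assume a: "a \<in> grid n k"
    show "v a * binprod a x = (if a = x then v x else 0)"
    proof (cases "wt n a = m")
      case True
      thus ?thesis using binprod_eq_delta[OF a assms(2)] assms(3) by (simp add: delta_def)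
    next
      case False
      hence "v a = 0" using layer_funs_eq_0[OF assms(1)] by blast
      thus ?thesis by auto
    qed
  qed
  thus ?thesis using assms(2) by (simp add: finite_grid)
qed

text \<open>Coordinatewise this is y * C(y - 1, b) = (y - b) * C(y, b). It shows that one
  application of \<open>up\<close> produces the factor by which consecutive factorials differ in
  \<open>up_pow_eq_exp_up\<close>.\<close>

lemma sum_binprod:
  "(\<Sum>i\<in>{1..n}. real (x i) * binprod a (x(i := x i - 1))) =
     (real (wt n x) - real (wt n a)) * binprod a x"
proof -
  have "real (x i) * binprod a (x(i := x i - 1)) = (real (x i) - real (a i)) * binprod a x"
    if i: "i \<in> {1..n}" for i
  proof -
    have eq: "real (x i) * real (x i - 1 choose a i) =
        (real (x i) - real (a i)) * real (x i choose a i)"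
    proof (cases "a i \<le> x i")
      case True
      thus ?thesis
        using arg_cong[OF binomial_absorb_comp[of "x i" "a i"], of real] by (simp add: of_nat_diff)
    qed (simp add: binomial_eq_0)
    have "binprod a y = real (y i choose a i) * (\<Prod>j\<in>{1..n} - {i}. real (y j choose a j))" for y
      unfolding binprod_def by (rule prod.remove) (use i in auto)
    note rem = this
    have "(\<Prod>j\<in>{1..n} - {i}. real ((x(i := x i - 1)) j choose a j)) =
        (\<Prod>j\<in>{1..n} - {i}. real (x j choose a j))"
      by (intro prod.cong) auto
    thus ?thesis using eq unfolding rem[of x] rem[of "x(i := x i - 1)"] by simp
  qed
  thus ?thesis
    by (simp add: wt_def sum_distrib_right[symmetric] sum_subtractf)
qed

lemma up_pow_eq_exp_up:
  assumes v: "v \<in> layer_funs m"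
  shows "x \<in> grid n k \<Longrightarrow> wt n x = m + r \<Longrightarrow> (up ^^ r) v x = fact r * exp_up v x"
proof (induction r arbitrary: x)
  case 0
  thus ?case using exp_up_low[OF v] by simp
next
  case (Suc r)
  have "(up ^^ Suc r) v x = (\<Sum>i\<in>{1..n}. real (x i) * (up ^^ r) v (x(i := x i - 1)))"
    using Suc.prems by (simp add: up_def)
  also have "\<dots> = (\<Sum>i\<in>{1..n}. real (x i) * (fact r * exp_up v (x(i := x i - 1))))"
  proof (intro sum.cong refl)
    fix i assume i: "i \<in> {1..n}"
    show "real (x i) * (up ^^ r) v (x(i := x i - 1)) =
        real (x i) * (fact r * exp_up v (x(i := x i - 1)))"
    \<comment> \<open>At \<open>x i = 0\<close> truncated subtraction leaves the point in its layer,
      out of reach of the induction hypothesis, but the factor is 0.\<close>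
    proof (cases "x i = 0")
      case False
      have g: "x(i := x i - 1) \<in> grid n k"
        using grid_le[OF Suc.prems(1) i] by (intro grid_upd Suc.prems i) auto
      have w: "wt n (x(i := x i - 1)) = m + r"
        using wt_upd[OF i, of x "x i - 1"] Suc.prems False by simp
      show ?thesis by (simp only: Suc.IH[OF g w])
    qed simp
  qed
  also have "\<dots> = fact r * (\<Sum>a\<in>grid n k. v a *
      (\<Sum>i\<in>{1..n}. real (x i) * binprod a (x(i := x i - 1))))"
    unfolding exp_up_def sum_distrib_left by (subst sum.swap) (simp add: mult_ac)
  also have "\<dots> = fact r * (\<Sum>a\<in>grid n k. real (Suc r) * (v a * binprod a x))"
  proof -
    have "v a * (\<Sum>i\<in>{1..n}. real (x i) * binprod a (x(i := x i - 1))) =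
        real (Suc r) * (v a * binprod a x)" for a
    proof (cases "wt n a = m")
      case True
      thus ?thesis unfolding sum_binprod using Suc.prems by simp
    next
      case False
      hence "v a = 0" using layer_funs_eq_0[OF v] by blast
      thus ?thesis by simp
    qed
    thus ?thesis by (simp only:)
  qed
  also have "\<dots> = fact (Suc r) * exp_up v x"
    unfolding exp_up_def by (simp add: sum_distrib_left mult_ac)
  finally show ?case .
qed

text \<open>From layer \<open>j\<close> to layer \<open>i\<close> the exponential acts as the power
  \<open>i - j\<close> of \<open>up\<close> divided by (i - j)!. With the factorials in
  \<open>string_vec\<close> this leaves (i - m)! / ((j - m)! (i - j)!), where m is the starting
  layer. Beyond the end of the string the power of \<open>up\<close> vanishes.\<close>

lemma exp_up_string_vec:
  assumes s: "s \<in> strings j" and x: "x \<in> grid n k" "wt n x = i"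
  shows "exp_up (string_vec j s) x =
    (if s \<in> strings i then real (i - fst s choose (j - fst s)) * string_vec i s x else 0)"
proof (cases "i < j")
  case True
  hence "exp_up (string_vec j s) x = 0"
    using exp_up_low[OF string_vec_layer[OF s] x(1)] layer_funs_eq_0[OF string_vec_layer[OF s]] x by simp
  moreover have "i - fst s < j - fst s" if "s \<in> strings i"
    using that True by (auto simp: strings_iff)
  ultimately show ?thesis by simp
next
  case False
  define m where "m = fst s"
  have m: "m \<le> j" "m + j \<le> max_wt" using s by (auto simp: strings_iff m_def)
  have "fact (i - j) * exp_up (string_vec j s) x = (up ^^ (i - j)) (string_vec j s) x"
    using up_pow_eq_exp_up[OF string_vec_layer[OF s] x(1), of "i - j"] x(2) False by simp
  also have "\<dots> = (up ^^ (i - m)) (snd s) x / fact (j - m)"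
  proof -
    have "string_vec j s = (\<lambda>x. \<Sum>t\<in>{()}. (1 / fact (j - m)) * (up ^^ (j - m)) (snd s) x)"
      by (simp add: string_vec_def m_def)
    moreover have "(up ^^ (i - j)) ((up ^^ (j - m)) (snd s)) = (up ^^ (i - m)) (snd s)"
      using m False by (simp add: funpow_add[symmetric, THEN fun_cong, unfolded comp_def])
    ultimately show ?thesis by (simp only: up_pow_lincomb) simp
  qed
  finally have eq: "exp_up (string_vec j s) x =
      (up ^^ (i - m)) (snd s) x / (fact (j - m) * fact (i - j))"
    by (simp add: field_simps)
  show ?thesis
  proof (cases "m + i \<le> max_wt")
    case True
    hence "s \<in> strings i" using s False by (auto simp: strings_iff m_def)
    moreover have "real (i - m choose (j - m)) = fact (i - m) / (fact (j - m) * fact (i - j))"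
      using binomial_fact[of "j - m" "i - m", where 'a = real] m False by simp
    ultimately show ?thesis unfolding eq by (simp add: string_vec_def m_def)
  next
    case False
    have "(up ^^ (i - m)) (snd s) = (\<lambda>_. 0)"
      by (rule string_end[OF strings_prim[OF s, folded m_def]]) (use False \<open>\<not> i < j\<close> m in auto)
    thus ?thesis unfolding eq using False by (simp add: strings_iff m_def)
  qed
qed

end

section \<open>Polynomial functions\<close>

text \<open>Extension by 0 matches the encoding of functions on \<open>A\<close> in
  \<open>poly_funs\<close>.\<close>

definition restr :: "'a set \<Rightarrow> ('a \<Rightarrow> real) \<Rightarrow> 'a \<Rightarrow> real" where
  "restr A f x = (if x \<in> A then f x else 0)"

definition mono_fun :: "nat \<Rightarrow> (nat \<Rightarrow> nat) \<Rightarrow> (nat \<Rightarrow> nat) \<Rightarrow> real" where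
  "mono_fun n e x = (\<Prod>i\<in>{1..n}. real (x i) ^ e i)"

lemma restr_lincomb: "restr A (\<lambda>x. \<Sum>s\<in>T. c s * u s x) = (\<lambda>x. \<Sum>s\<in>T. c s * restr A (u s) x)"
  by (rule ext) (simp add: restr_def)

lemma lincomb_in_span:
  assumes "\<And>s. s \<in> T \<Longrightarrow> u s \<in> fun_vs.span H"
  shows "(\<lambda>x. \<Sum>s\<in>T. c s * u s x) \<in> fun_vs.span H"
  unfolding sum_fscale[symmetric]
  by (intro fun_vs.span_sum fun_vs.span_scale assms)

lemma lincomb_in_subspace:
  assumes "fun_vs.subspace V" "\<And>s. s \<in> T \<Longrightarrow> u s \<in> V"
  shows "(\<lambda>x. \<Sum>s\<in>T. c s * u s x) \<in> V"
  unfolding sum_fscale[symmetric]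
  by (intro fun_vs.subspace_sum fun_vs.subspace_scale assms)

lemma peval_superset:
  assumes "finite M" "Poly_Mapping.keys p \<subseteq> M"
  shows "peval p x = (\<Sum>m\<in>M. Poly_Mapping.lookup p m *
    (\<Prod>i\<in>Poly_Mapping.keys m. x i ^ Poly_Mapping.lookup m i))"
  unfolding peval_def
  by (rule sum.mono_neutral_left) (use assms in \<open>auto simp: in_keys_iff\<close>)

lemma poly_funs_subspace: "fun_vs.subspace (poly_funs n d A)"
proof (rule fun_vs.subspaceI)
  show "0 \<in> poly_funs n d A"
    unfolding poly_funs_def polys_upto_def
    by (auto intro!: exI[of _ 0] simp: peval_def)
next
  fix f g assume fg: "f \<in> poly_funs n d A" "g \<in> poly_funs n d A"
  obtain p where p: "p \<in> polys_upto n d" "\<And>x. x \<in> A \<Longrightarrow> f x = peval p (\<lambda>i. real (x i))"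
    using fg(1) by (auto simp: poly_funs_def)
  obtain q where q: "q \<in> polys_upto n d" "\<And>x. x \<in> A \<Longrightarrow> g x = peval q (\<lambda>i. real (x i))"
    using fg(2) by (auto simp: poly_funs_def)
  \<comment> \<open>Cancellation can shrink the support of the sum, so all three polynomials are
    evaluated over the union of the supports.\<close>
  have keys: "Poly_Mapping.keys (p + q) \<subseteq> Poly_Mapping.keys p \<union> Poly_Mapping.keys q"
    by (rule Poly_Mapping.keys_add)
  have "p + q \<in> polys_upto n d" using keys p(1) q(1) unfolding polys_upto_def by blast
  moreover have "peval (p + q) x = peval p x + peval q x" for x
    unfolding peval_superset[OF _ keys, simplified]
      peval_superset[of "Poly_Mapping.keys p \<union> Poly_Mapping.keys q" p, simplified]
      peval_superset[of "Poly_Mapping.keys p \<union> Poly_Mapping.keys q" q, simplified]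
    by (simp add: lookup_add distrib_right sum.distrib)
  ultimately show "f + g \<in> poly_funs n d A"
    using fg p q by (auto simp: poly_funs_def intro!: bexI[of _ "p + q"])
next
  fix c f assume f: "f \<in> poly_funs n d A"
  obtain p where p: "p \<in> polys_upto n d" "\<And>x. x \<in> A \<Longrightarrow> f x = peval p (\<lambda>i. real (x i))"
    using f by (auto simp: poly_funs_def)
  define q where "q = Poly_Mapping.map (\<lambda>a. c * a) p"
  have lq: "Poly_Mapping.lookup q m = c * Poly_Mapping.lookup p m" for m
    unfolding q_def by (simp add: Poly_Mapping.map.rep_eq when_def)
  have keys: "Poly_Mapping.keys q \<subseteq> Poly_Mapping.keys p"
    by (auto simp: in_keys_iff lq)
  have "q \<in> polys_upto n d" using keys p(1) unfolding polys_upto_def by blast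
  moreover have "peval q x = c * peval p x" for x
    unfolding peval_superset[OF _ keys, simplified]
    by (simp add: peval_def lq sum_distrib_left mult.assoc)
  ultimately show "fscale c f \<in> poly_funs n d A"
    using f p by (auto simp: poly_funs_def fscale_def intro!: bexI[of _ q])
qed

text \<open>Together with \<open>poly_funs_span_mono\<close> this replaces formal polynomials by
  spans of monomial functions indexed by exponent functions.\<close>

lemma mono_fun_poly:
  assumes "sum e {1..n} \<le> d"
  shows "restr A (mono_fun n e) \<in> poly_funs n d A"
proof -
  \<comment> \<open>Exponents outside \<open>{1..n}\<close> are cut off to obtain finite
    support.\<close>
  define m where "m = Abs_poly_mapping (\<lambda>i. if i \<in> {1..n} then e i else 0)"
  have lm: "Poly_Mapping.lookup m i = (if i \<in> {1..n} then e i else 0)" for i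
  proof -
    have "finite {i. (if i \<in> {1..n} then e i else 0) \<noteq> 0}"
      by (rule finite_subset[of _ "{1..n}"]) auto
    thus ?thesis unfolding m_def by (simp add: lookup_Abs_poly_mapping)
  qed
  have keys: "Poly_Mapping.keys m \<subseteq> {1..n}" by (auto simp: in_keys_iff lm split: if_splits)
  have "monom_deg m = sum e {1..n}"
    unfolding monom_deg_def
    by (rule sum.mono_neutral_cong_left) (use keys in \<open>auto simp: in_keys_iff lm\<close>)
  hence "Poly_Mapping.single m 1 \<in> polys_upto n d"
    using assms keys by (simp add: polys_upto_def)
  moreover have "peval (Poly_Mapping.single m 1) (\<lambda>i. real (x i)) = mono_fun n e x" for x
  proof -
    have "peval (Poly_Mapping.single m 1) (\<lambda>i. real (x i)) =
        (\<Prod>i\<in>Poly_Mapping.keys m. real (x i) ^ Poly_Mapping.lookup m i)"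
      by (simp add: peval_def)
    also have "\<dots> = mono_fun n e x"
      unfolding mono_fun_def
      by (rule prod.mono_neutral_cong_left) (use keys in \<open>auto simp: in_keys_iff lm\<close>)
    finally show ?thesis .
  qed
  ultimately show ?thesis
    by (auto simp: poly_funs_def restr_def intro!: bexI[of _ "Poly_Mapping.single m 1"])
qed

lemma poly_funs_span_mono:
  assumes "f \<in> poly_funs n d A"
  shows "f \<in> fun_vs.span ((\<lambda>e. restr A (mono_fun n e)) ` {e. sum e {1..n} \<le> d})"
proof -
  obtain p where p: "p \<in> polys_upto n d" "\<And>x. x \<in> A \<Longrightarrow> f x = peval p (\<lambda>i. real (x i))"
    and f0: "\<And>x. x \<notin> A \<Longrightarrow> f x = 0"
    using assms by (auto simp: poly_funs_def)
  let ?e = "\<lambda>m. Poly_Mapping.lookup m"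
  have e: "sum (?e m) {1..n} \<le> d"
    "(\<Prod>i\<in>Poly_Mapping.keys m. real (x i) ^ Poly_Mapping.lookup m i) = mono_fun n (?e m) x"
    if "m \<in> Poly_Mapping.keys p" for m x
  proof -
    have keys: "Poly_Mapping.keys m \<subseteq> {1..n}" and deg: "monom_deg m \<le> d"
      using p(1) that by (auto simp: polys_upto_def)
    have "monom_deg m = sum (?e m) {1..n}"
      unfolding monom_deg_def
      by (rule sum.mono_neutral_left) (use keys in \<open>auto simp: in_keys_iff\<close>)
    with deg show "sum (?e m) {1..n} \<le> d" by simp
    show "(\<Prod>i\<in>Poly_Mapping.keys m. real (x i) ^ Poly_Mapping.lookup m i) = mono_fun n (?e m) x"
      unfolding mono_fun_def
      by (rule prod.mono_neutral_left) (use keys in \<open>auto simp: in_keys_iff\<close>)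
  qed
  have "f = (\<lambda>x. \<Sum>m\<in>Poly_Mapping.keys p. Poly_Mapping.lookup p m * restr A (mono_fun n (?e m)) x)"
  proof
    fix x
    show "f x = (\<Sum>m\<in>Poly_Mapping.keys p. Poly_Mapping.lookup p m * restr A (mono_fun n (?e m)) x)"
      using p(2)[of x] f0[of x] by (cases "x \<in> A") (simp_all add: restr_def peval_def e(2))
  qed
  also have "\<dots> \<in> fun_vs.span ((\<lambda>e. restr A (mono_fun n e)) ` {e. sum e {1..n} \<le> d})"
    by (intro lincomb_in_span fun_vs.span_base imageI CollectI e(1))
  finally show ?thesis .
qed

section \<open>Binomial coefficients as polynomials in one variable\<close>

definition binom_poly :: "nat \<Rightarrow> real poly" where
  "binom_poly l = smult (1 / fact l) (\<Prod>i<l. [:- real i, 1:])"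

lemma poly_binom_poly: "poly (binom_poly l) (real y) = real (y choose l)"
  unfolding binom_poly_def
  by (simp add: poly_prod binomial_gbinomial gbinomial_prod_rev atLeast0LessThan)

lemma degree_binom_poly: "degree (binom_poly l) \<le> l"
proof -
  have "degree (\<Prod>i<l. [:- real i, 1:]) \<le> (\<Sum>i<l. degree [:- real i, 1:])"
    by (rule degree_prod_sum_le[unfolded comp_def]) simp
  thus ?thesis unfolding binom_poly_def by simp
qed

text \<open>The Vandermonde argument: a polynomial of degree below \<open>r\<close> with at least
  \<open>r\<close> roots is zero. Evaluating it at \<open>y = l\<close> then isolates
  \<open>c l\<close>, since \<open>l choose i\<close> vanishes for \<open>i > l\<close> and smaller
  indices are covered by induction.\<close>

lemma binomial_sum_zero:
  fixes c :: "nat \<Rightarrow> real"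
  assumes X: "finite X" "r \<le> card X" and z: "\<And>y. y \<in> X \<Longrightarrow> (\<Sum>l<r. c l * real (y choose l)) = 0"
    and l: "l < r"
  shows "c l = 0"
proof -
  define p where "p = (\<Sum>l<r. smult (c l) (binom_poly l))"
  have pv: "poly p (real y) = (\<Sum>l<r. c l * real (y choose l))" for y
    unfolding p_def by (simp add: poly_sum poly_binom_poly)
  have "degree p < r"
    unfolding p_def using l
    by (intro degree_sum_less) (auto intro: le_less_trans[OF degree_smult_le] le_less_trans[OF degree_binom_poly])
  have "p = 0"
  proof (rule ccontr)
    assume p: "p \<noteq> 0"
    have "real ` X \<subseteq> {x. poly p x = 0}" using z pv by auto
    hence "card (real ` X) \<le> card {x. poly p x = 0}" by (intro card_mono poly_roots_finite p)
    also have "\<dots> \<le> degree p" by (rule card_poly_roots_bound[OF p])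
    finally show False using X \<open>degree p < r\<close> by (simp add: card_image)
  qed
  hence z: "(\<Sum>l<r. c l * real (y choose l)) = 0" for y using pv[of y] by simp
  show ?thesis using l
  proof (induction l rule: less_induct)
    case (less l)
    have "0 = (\<Sum>i<r. c i * real (l choose i))" using z[of l] by simp
    also have "\<dots> = (\<Sum>i\<in>{l}. c i * real (l choose i))"
    proof (rule sum.mono_neutral_right)
      show "\<forall>i\<in>{..<r} - {l}. c i * real (l choose i) = 0"
      proof
        fix i assume "i \<in> {..<r} - {l}"
        thus "c i * real (l choose i) = 0" using less.IH[of i] by (cases "i < l") auto
      qed
    qed (use less.prems in auto)
    finally show ?case by simp
  qed
qed

lemma binomial_power_expansion:
  "\<exists>s. \<forall>y. real (y choose l) = (\<Sum>j\<le>l. s j * real y ^ j)"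
proof (intro exI allI)
  fix y
  have "real (y choose l) = (\<Sum>j\<le>degree (binom_poly l). coeff (binom_poly l) j * real y ^ j)"
    by (simp flip: poly_binom_poly add: poly_altdef)
  also have "\<dots> = (\<Sum>j\<le>l. coeff (binom_poly l) j * real y ^ j)"
    by (rule sum.mono_neutral_left) (use degree_binom_poly[of l] in \<open>auto simp: coeff_eq_0\<close>)
  finally show "real (y choose l) = (\<Sum>j\<le>l. coeff (binom_poly l) j * real y ^ j)" .
qed

text \<open>The induction step multiplies by y, using y * C(y, l) = l * C(y, l) + (l + 1) * C(y, l +
  1).\<close>

lemma power_binomial_expansion:
  "\<exists>s. \<forall>y. real y ^ e = (\<Sum>l\<le>e. s l * real (y choose l))"
proof (induction e)
  case 0
  show ?case by (intro exI[of _ "\<lambda>_. 1"]) simp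
next
  case (Suc e)
  then obtain s where s: "\<And>y. real y ^ e = (\<Sum>l\<le>e. s l * real (y choose l))" by blast
  \<comment> \<open>The two summands collect the contributions of the recurrence that keep
    \<open>l\<close> and that raise \<open>l - 1\<close> to \<open>l\<close>.\<close>
  define s' where "s' = (\<lambda>l. (if l \<le> e then s l * real l else 0) + (if l = 0 then 0 else s (l - 1) * real l))"
  have "real y ^ Suc e = (\<Sum>l\<le>Suc e. s' l * real (y choose l))" for y
  proof -
    have absorb: "real y * real (y choose l) = real l * real (y choose l) + real (Suc l) * real (y choose Suc l)" for l
    proof (cases "l \<le> y")
      case True
      have "Suc l * (y choose Suc l) = (y - l) * (y choose l)"
        by (metis binomial_absorb_comp binomial_absorption mult.commute times_binomial_minus1_eq diff_Suc_1 zero_less_Suc)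
      hence "real (Suc l) * real (y choose Suc l) = (real y - real l) * real (y choose l)"
        using True by (metis of_nat_diff of_nat_mult)
      thus ?thesis by (simp add: algebra_simps)
    qed (simp add: binomial_eq_0)
    have "real y ^ Suc e = (\<Sum>l\<le>e. s l * (real y * real (y choose l)))"
      by (simp add: s sum_distrib_left mult_ac)
    also have "\<dots> = (\<Sum>l\<le>e. s l * real l * real (y choose l)) +
        (\<Sum>l\<le>e. s l * real (Suc l) * real (y choose Suc l))"
      unfolding absorb sum.distrib[symmetric] by (simp add: algebra_simps)
    also have "(\<Sum>l\<le>e. s l * real l * real (y choose l)) =
        (\<Sum>l\<le>Suc e. (if l \<le> e then s l * real l else 0) * real (y choose l))"
      by simp
    also have "(\<Sum>l\<le>e. s l * real (Suc l) * real (y choose Suc l)) =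
        (\<Sum>l\<le>Suc e. (if l = 0 then 0 else s (l - 1) * real l) * real (y choose l))"
      by (subst sum.atMost_Suc_shift) simp
    finally show ?thesis unfolding s'_def by (simp only: sum.distrib distrib_right)
  qed
  thus ?case by blast
qed

context rect_grid
begin

section \<open>Exchanging monomials and products of binomial coefficients\<close>

lemma binprod_span_mono:
  assumes "wt n a \<le> d"
  shows "restr A (binprod a) \<in>
    fun_vs.span ((\<lambda>e. restr A (mono_fun n e)) ` {e. sum e {1..n} \<le> d})"
proof -
  obtain s where s: "\<And>l y. real (y choose l) = (\<Sum>j\<le>l. s l j * real y ^ j)"
    using binomial_power_expansion by metis
  let ?P = "PiE {1..n} (\<lambda>i. {..a i})"
  have "binprod a = (\<lambda>x. \<Sum>e\<in>?P. (\<Prod>i\<in>{1..n}. s (a i) (e i)) * mono_fun n e x)"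
  proof
    fix x
    have "binprod a x = (\<Prod>i\<in>{1..n}. \<Sum>j\<in>{..a i}. s (a i) j * real (x i) ^ j)"
      unfolding binprod_def s ..
    also have "\<dots> = (\<Sum>e\<in>?P. \<Prod>i\<in>{1..n}. s (a i) (e i) * real (x i) ^ e i)"
      by (rule prod_sum_PiE) auto
    finally show "binprod a x = (\<Sum>e\<in>?P. (\<Prod>i\<in>{1..n}. s (a i) (e i)) * mono_fun n e x)"
      by (simp add: mono_fun_def prod.distrib)
  qed
  moreover have "sum e {1..n} \<le> d" if "e \<in> ?P" for e
  proof -
    have "sum e {1..n} \<le> sum a {1..n}" using that by (intro sum_mono) auto
    thus ?thesis using assms by (simp add: wt_def)
  qed
  ultimately show ?thesis
    by (simp add: restr_lincomb lincomb_in_span fun_vs.span_base)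
qed

lemma mono_span_binprod:
  assumes "sum e {1..n} \<le> d" "A \<subseteq> grid n k"
  shows "restr A (mono_fun n e) \<in>
    fun_vs.span ((\<lambda>a. restr A (binprod a)) ` {a \<in> grid n k. wt n a \<le> d})"
proof -
  obtain s where s: "\<And>l y. real y ^ l = (\<Sum>j\<le>l. s l j * real (y choose j))"
    using power_binomial_expansion by metis
  let ?P = "PiE {1..n} (\<lambda>i. {..e i})"
  have "mono_fun n e = (\<lambda>x. \<Sum>a\<in>?P. (\<Prod>i\<in>{1..n}. s (e i) (a i)) * binprod a x)"
  proof
    fix x
    have "mono_fun n e x = (\<Prod>i\<in>{1..n}. \<Sum>j\<in>{..e i}. s (e i) j * real (x i choose j))"
      unfolding mono_fun_def s ..
    also have "\<dots> = (\<Sum>a\<in>?P. \<Prod>i\<in>{1..n}. s (e i) (a i) * real (x i choose a i))"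
      by (rule prod_sum_PiE) auto
    finally show "mono_fun n e x = (\<Sum>a\<in>?P. (\<Prod>i\<in>{1..n}. s (e i) (a i)) * binprod a x)"
      by (simp add: binprod_def prod.distrib)
  qed
  moreover have "restr A (binprod a) \<in>
      fun_vs.span ((\<lambda>a. restr A (binprod a)) ` {a \<in> grid n k. wt n a \<le> d})"
    if a: "a \<in> ?P" for a
  proof (cases "a \<in> grid n k")
    case True
    have "wt n a \<le> sum e {1..n}" unfolding wt_def using a by (intro sum_mono) auto
    with True assms(1) show ?thesis by (intro fun_vs.span_base imageI) auto
  next
    \<comment> \<open>The expansion can produce indices \<open>a\<close> outside the grid, but then
      some binomial factor vanishes throughout \<open>A\<close>.\<close>
    case False
    then obtain i where i: "i \<in> {1..n}" "k i - 1 < a i"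
      using a by (auto simp: grid_def PiE_iff not_le)
    have "binprod a x = 0" if "x \<in> A" for x
    proof -
      have "x i < a i" using grid_le[of x i] i assms(2) that by auto
      thus ?thesis unfolding binprod_def using i(1) by (intro prod_zero) auto
    qed
    hence "restr A (binprod a) = 0" by (auto simp: restr_def fun_eq_iff)
    thus ?thesis by (simp add: fun_vs.span_zero)
  qed
  ultimately show ?thesis
    by (simp add: restr_lincomb lincomb_in_span)
qed

text \<open>As \<open>binprod a\<close> is the exponential of a point mass, this describes
  polynomial functions as restrictions of the exponential image of the layers up to
  \<open>d\<close>.\<close>

lemma poly_funs_eq_span:
  assumes "A \<subseteq> grid n k"
  shows "poly_funs n d A =
    fun_vs.span ((\<lambda>a. restr A (binprod a)) ` {a \<in> grid n k. wt n a \<le> d})"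
proof (rule antisym)
  let ?M = "(\<lambda>e. restr A (mono_fun n e)) ` {e. sum e {1..n} \<le> d}"
  let ?B = "(\<lambda>a. restr A (binprod a)) ` {a \<in> grid n k. wt n a \<le> d}"
  have "?M \<subseteq> fun_vs.span ?B" using mono_span_binprod[OF _ assms] by auto
  hence "fun_vs.span ?M \<subseteq> fun_vs.span ?B"
    by (rule fun_vs.span_minimal[OF _ fun_vs.subspace_span])
  thus "poly_funs n d A \<subseteq> fun_vs.span ?B" using poly_funs_span_mono by auto
  have "?M \<subseteq> poly_funs n d A" using mono_fun_poly by auto
  hence "fun_vs.span ?M \<subseteq> poly_funs n d A"
    by (rule fun_vs.span_minimal[OF _ poly_funs_subspace])
  moreover have "?B \<subseteq> fun_vs.span ?M" using binprod_span_mono by auto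
  ultimately have "?B \<subseteq> poly_funs n d A" by (rule order_trans[rotated])
  thus "fun_vs.span ?B \<subseteq> poly_funs n d A"
    by (rule fun_vs.span_minimal[OF _ poly_funs_subspace])
qed

section \<open>The Hilbert function of a union of layers\<close>

text \<open>The condition on \<open>m\<close> says that the range from \<open>m\<close> to
  \<open>max_wt - m\<close> is nonempty.\<close>

definition all_strings :: "(nat \<times> ((nat \<Rightarrow> nat) \<Rightarrow> real)) set" where
  "all_strings = Sigma {m. 2 * m \<le> max_wt} prim_basis"

lemma finite_all_strings: "finite all_strings"
proof -
  have "{m. 2 * m \<le> max_wt} \<subseteq> {..max_wt}" by auto
  thus ?thesis
    unfolding all_strings_def using finite_subset by (intro finite_SigmaI prim_basis(1)) blast
qed

lemma strings_subset: "strings j \<subseteq> all_strings"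
  by (auto simp: strings_def all_strings_def)

lemma all_strings_strings_iff:
  "s \<in> all_strings \<Longrightarrow> s \<in> strings j \<longleftrightarrow> fst s \<le> j \<and> fst s + j \<le> max_wt"
  by (cases s) (auto simp: strings_def all_strings_def)

definition hits :: "nat set \<Rightarrow> nat \<times> ((nat \<Rightarrow> nat) \<Rightarrow> real) \<Rightarrow> nat set" where
  "hits E s = {i \<in> E. s \<in> strings i}"

text \<open>For \<open>l\<close> such that the string meets layer \<open>m + l\<close>, this is the
  exponential of its vector there, restricted to the layers in \<open>E\<close>; see
  \<open>restr_exp_up_string_vec\<close>.\<close>

definition string_fun ::
  "nat set \<Rightarrow> (nat \<times> ((nat \<Rightarrow> nat) \<Rightarrow> real)) \<times> nat \<Rightarrow> (nat \<Rightarrow> nat) \<Rightarrow> real" where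
  "string_fun E sl = (\<lambda>x. \<Sum>i\<in>hits E (fst sl).
     real (i - fst (fst sl) choose snd sl) * string_vec i (fst sl) x)"

lemma string_fun_layer:
  assumes "finite E" "s \<in> all_strings" "x \<in> grid n k" "wt n x = i" "i \<in> E"
  shows "string_fun E (s, l) x =
    (if s \<in> strings i then real (i - fst s choose l) * string_vec i s x else 0)"
proof -
  have "string_fun E (s, l) x =
      (\<Sum>j\<in>hits E s. if j = i then real (i - fst s choose l) * string_vec i s x else 0)"
    unfolding string_fun_def
    by (intro sum.cong)
       (use assms layer_funs_eq_0[OF string_vec_layer, of s] in \<open>auto simp: hits_def\<close>)
  also have "\<dots> = (if s \<in> strings i then real (i - fst s choose l) * string_vec i s x else 0)"
    using assms(1,5) by (simp add: hits_def)
  finally show ?thesis .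
qed

lemma string_fun_outside:
  assumes "x \<notin> layers n k E"
  shows "string_fun E sl x = 0"
proof -
  have "string_vec i (fst sl) x = 0" if "i \<in> hits E (fst sl)" for i
    using layer_funs_eq_0[OF string_vec_layer, of "fst sl" i x] assms that
    by (auto simp: hits_def layers_def)
  thus ?thesis unfolding string_fun_def by (simp add: sum.neutral)
qed

lemma restr_exp_up_string_vec:
  assumes "finite E" "s \<in> strings j"
  shows "restr (layers n k E) (exp_up (string_vec j s)) = string_fun E (s, j - fst s)"
proof
  fix x
  show "restr (layers n k E) (exp_up (string_vec j s)) x = string_fun E (s, j - fst s) x"
  proof (cases "x \<in> layers n k E")
    case True
    hence x: "x \<in> grid n k" "wt n x \<in> E" by (auto simp: layers_def)
    show ?thesis
      using string_fun_layer[OF assms(1) subsetD[OF strings_subset assms(2)] x(1) refl x(2)]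
        exp_up_string_vec[OF assms(2) x(1) refl] True
      by (simp add: restr_def)
  next
    case False
    thus ?thesis by (simp add: string_fun_outside restr_def)
  qed
qed

text \<open>The rank of the matrix of binomials \<open>i - m choose l\<close> with
  \<open>l \<le> d - m\<close> and \<open>i\<close> in \<open>hits E s\<close>. Truncated
  subtraction gives 0 when the string starts above layer \<open>d\<close>.\<close>

definition string_rank :: "nat \<Rightarrow> nat set \<Rightarrow> nat \<times> ((nat \<Rightarrow> nat) \<Rightarrow> real) \<Rightarrow> nat" where
  "string_rank d E s = min (Suc d - fst s) (card (hits E s))"

text \<open>Independence of string vectors within each layer separates a relation into one relation
  per string and layer. For a fixed string these say that a combination of binomials vanishes at all
  layers hit, and \<open>binomial_sum_zero\<close> applies.\<close>

lemma string_fun_indep: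
  assumes "finite E"
  shows "indep_family (Sigma all_strings (\<lambda>s. {..<string_rank d E s})) (string_fun E)"
proof (rule indep_familyI)
  let ?K = "Sigma all_strings (\<lambda>s. {..<string_rank d E s})"
  fix c sl assume c: "\<And>x. (\<Sum>sl\<in>?K. c sl * string_fun E sl x) = 0" and sl: "sl \<in> ?K"
  obtain s l where sl_eq: "sl = (s, l)" by (cases sl)
  have s: "s \<in> all_strings" "l < string_rank d E s" using sl by (auto simp: sl_eq)
  \<comment> \<open>The coefficient of \<open>string_vec i s\<close> when the relation is read on
    layer \<open>i\<close>.\<close>
  define q where "q = (\<lambda>i s. \<Sum>l<string_rank d E s. c (s, l) * real (i - fst s choose l))"
  have q: "q i s = 0" if i: "i \<in> E" "s \<in> strings i" for i s
  proof (rule indep_familyD[OF strings_indep _ i(2)])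
    fix x
    show "(\<Sum>s\<in>strings i. q i s * string_vec i s x) = 0"
    proof (cases "x \<in> layers n k {i}")
      case False
      thus ?thesis using string_vec_layer by (auto simp: layer_funs_def intro!: sum.neutral)
    next
      case True
      hence x: "x \<in> grid n k" "wt n x = i" by (auto simp: in_layer)
      have "0 = (\<Sum>s\<in>all_strings. \<Sum>l<string_rank d E s. c (s, l) * string_fun E (s, l) x)"
        using c[of x] finite_all_strings by (subst sum.Sigma) (auto simp: case_prod_beta)
      also have "\<dots> = (\<Sum>s\<in>all_strings. if s \<in> strings i then q i s * string_vec i s x else 0)"
      proof (rule sum.cong[OF refl])
        fix s assume "s \<in> all_strings"
        note * = string_fun_layer[OF assms this x i(1)]
        show "(\<Sum>l<string_rank d E s. c (s, l) * string_fun E (s, l) x) =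
            (if s \<in> strings i then q i s * string_vec i s x else 0)"
          unfolding * q_def by (simp add: sum_distrib_right mult.assoc)
      qed
      also have "\<dots> = (\<Sum>s\<in>strings i. q i s * string_vec i s x)"
        by (simp add: sum.inter_restrict[OF finite_all_strings, symmetric]
            Int_absorb1[OF strings_subset])
      finally show ?thesis by simp
    qed
  qed
  have "c (s, l) = 0"
  proof (rule binomial_sum_zero[OF _ _ _ s(2)])
    let ?X = "(\<lambda>i. i - fst s) ` hits E s"
    show "finite ?X" using assms by (simp add: hits_def)
    \<comment> \<open>Every layer hit is at least \<open>fst s\<close>, so truncated subtraction
      loses nothing.\<close>
    have "inj_on (\<lambda>i. i - fst s) (hits E s)"
      by (rule inj_onI) (auto simp: hits_def strings_iff)
    thus "string_rank d E s \<le> card ?X" by (simp add: card_image string_rank_def)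
    show "(\<Sum>l<string_rank d E s. c (s, l) * real (y choose l)) = 0" if y: "y \<in> ?X" for y
    proof -
      obtain i where "y = i - fst s" "i \<in> E" "s \<in> strings i" using y by (auto simp: hits_def)
      with q[of i s] show ?thesis by (simp add: q_def)
    qed
  qed
  thus "c sl = 0" by (simp add: sl_eq)
qed

lemma restr_exp_up_poly:
  assumes "v \<in> layer_funs j" "j \<le> d" "A \<subseteq> grid n k"
  shows "restr A (exp_up v) \<in> poly_funs n d A"
proof -
  have "exp_up v = (\<lambda>x. \<Sum>a\<in>layers n k {j}. v a * binprod a x)"
    unfolding exp_up_def using layer_funs_eq_0[OF assms(1)]
    by (intro ext sum.mono_neutral_right) (auto simp: finite_grid layers_def)
  moreover have "restr A (binprod a) \<in> poly_funs n d A" if "a \<in> layers n k {j}" for a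
    unfolding poly_funs_eq_span[OF assms(3)]
    using that assms(2) by (intro fun_vs.span_base imageI) (auto simp: in_layer)
  ultimately show ?thesis
    by (simp add: restr_lincomb lincomb_in_subspace poly_funs_subspace)
qed

text \<open>The rank bounds \<open>l\<close> twice: by \<open>d - m\<close>, so the degree is at
  most \<open>d\<close>, and by the length of the string, so that it has a vector in layer
  \<open>m + l\<close>.\<close>

lemma string_fun_poly:
  assumes "finite E" "s \<in> all_strings" "l < string_rank d E s"
  shows "string_fun E (s, l) \<in> poly_funs n d (layers n k E)"
proof -
  define m where "m = fst s"
  have m: "2 * m \<le> max_wt" using assms(2) by (auto simp: all_strings_def m_def)
  have "hits E s \<subseteq> {m..max_wt - m}"
    using m by (auto simp: hits_def strings_iff m_def)
  from card_mono[OF _ this] have "card (hits E s) \<le> Suc (max_wt - m) - m" by simp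
  hence l: "m + l \<le> d" "m + (m + l) \<le> max_wt"
    using assms(3) m by (auto simp: string_rank_def m_def)
  hence s: "s \<in> strings (m + l)"
    using assms(2) by (simp add: all_strings_strings_iff m_def)
  have "layers n k E \<subseteq> grid n k" by (auto simp: layers_def)
  from restr_exp_up_poly[OF string_vec_layer[OF s] l(1) this]
  show ?thesis unfolding restr_exp_up_string_vec[OF assms(1) s] by (simp add: m_def)
qed

text \<open>For the upper bound, the smaller of two sets spanning the contribution of a string: its
  functions up to degree \<open>d\<close>, or its vectors in the layers of \<open>E\<close>.\<close>

definition span_set ::
  "nat \<Rightarrow> nat set \<Rightarrow> nat \<times> ((nat \<Rightarrow> nat) \<Rightarrow> real) \<Rightarrow> ((nat \<Rightarrow> nat) \<Rightarrow> real) set" where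
  "span_set d E s =
     (if Suc d - fst s \<le> card (hits E s) then (\<lambda>l. string_fun E (s, l)) ` {..<Suc d - fst s}
      else (\<lambda>i. string_vec i s) ` hits E s)"

lemma finite_span_set: "finite E \<Longrightarrow> finite (span_set d E s)"
  by (simp add: span_set_def hits_def)

lemma card_span_set:
  assumes "finite E"
  shows "card (span_set d E s) \<le> string_rank d E s"
proof -
  have "finite (hits E s)" using assms by (simp add: hits_def)
  thus ?thesis unfolding span_set_def string_rank_def
    using card_image_le[of "hits E s" "\<lambda>i. string_vec i s"]
      card_image_le[of "{..<Suc d - fst s}" "\<lambda>l. string_fun E (s, l)"]
    by auto
qed

lemma string_fun_in_span:
  assumes "s \<in> strings j" "j \<le> d"
  shows "string_fun E (s, j - fst s) \<in> fun_vs.span (span_set d E s)"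
proof (cases "Suc d - fst s \<le> card (hits E s)")
  case True
  have "j - fst s < Suc d - fst s" using assms by (auto simp: strings_iff)
  with True show ?thesis by (auto simp: span_set_def intro!: fun_vs.span_base)
next
  case False
  hence eq: "span_set d E s = (\<lambda>i. string_vec i s) ` hits E s" by (simp add: span_set_def)
  show ?thesis
    unfolding string_fun_def eq fst_conv by (intro lincomb_in_span fun_vs.span_base imageI)
qed

text \<open>Each generator is the restricted exponential of a point mass; expanding the point mass
  in the strings through its layer reduces the claim to single strings.\<close>

lemma poly_funs_subset_span:
  assumes "finite E"
  shows "poly_funs n d (layers n k E) \<subseteq> fun_vs.span (\<Union>s\<in>all_strings. span_set d E s)"
proof -
  let ?A = "layers n k E" and ?H = "\<Union>s\<in>all_strings. span_set d E s"
  have A: "?A \<subseteq> grid n k" by (auto simp: layers_def)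
  have "restr ?A (binprod a) \<in> fun_vs.span ?H" if a: "a \<in> grid n k" "wt n a \<le> d" for a
  proof (rule span_familyE)
    let ?j = "wt n a"
    have "delta a \<in> layer_funs ?j" using a by (intro delta_layer) (simp add: in_layer)
    thus "delta a \<in> fun_vs.span (string_vec ?j ` strings ?j)"
      using wt_le[OF a(1)] by (rule strings_span)
    show "finite (strings ?j)" "inj_on (string_vec ?j) (strings ?j)"
      by (rule finite_strings indep_family_inj[OF finite_strings strings_indep])+
    fix c assume "\<And>x. delta a x = (\<Sum>s\<in>strings ?j. c s * string_vec ?j s x)"
    hence "delta a = (\<lambda>x. \<Sum>s\<in>strings ?j. c s * string_vec ?j s x)" by (rule ext)
    hence "restr ?A (binprod a) = (\<lambda>x. \<Sum>s\<in>strings ?j. c s * restr ?A (exp_up (string_vec ?j s)) x)"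
      unfolding exp_up_delta[OF a(1), symmetric] by (simp only: exp_up_lincomb restr_lincomb)
    also have "\<dots> \<in> fun_vs.span ?H"
    proof (rule lincomb_in_span)
      fix s assume s: "s \<in> strings ?j"
      have "span_set d E s \<subseteq> ?H" using strings_subset s by blast
      from subsetD[OF fun_vs.span_mono[OF this] string_fun_in_span[OF s a(2)]]
      show "restr ?A (exp_up (string_vec ?j s)) \<in> fun_vs.span ?H"
        unfolding restr_exp_up_string_vec[OF assms s] .
    qed
    finally show "restr ?A (binprod a) \<in> fun_vs.span ?H" .
  qed
  hence "(\<lambda>a. restr ?A (binprod a)) ` {a \<in> grid n k. wt n a \<le> d} \<subseteq> fun_vs.span ?H" by auto
  thus ?thesis
    unfolding poly_funs_eq_span[OF A] by (rule fun_vs.span_minimal[OF _ fun_vs.subspace_span])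
qed

lemma hilb_eq_sum_rank:
  assumes "finite E"
  shows "hilb n d (layers n k E) = (\<Sum>s\<in>all_strings. string_rank d E s)"
proof -
  let ?K = "Sigma all_strings (\<lambda>s. {..<string_rank d E s})"
  let ?H = "\<Union>s\<in>all_strings. span_set d E s"
  have card: "card ?K = (\<Sum>s\<in>all_strings. string_rank d E s)"
    by (subst card_SigmaI) (auto simp: finite_all_strings)
  have "fun_vs.dim (poly_funs n d (layers n k E)) = card ?K"
  proof (rule dim_eq_card_family[OF _ string_fun_indep[OF assms] _ _ poly_funs_subset_span[OF assms]])
    show "finite ?K" using finite_all_strings by auto
    show "string_fun E ` ?K \<subseteq> poly_funs n d (layers n k E)"
      using string_fun_poly[OF assms] by auto
    show "finite ?H" using finite_all_strings finite_span_set[OF assms] by auto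
    have "card ?H \<le> (\<Sum>s\<in>all_strings. card (span_set d E s))"
      by (rule card_UN_le[OF finite_all_strings])
    also have "\<dots> \<le> card ?K" unfolding card by (intro sum_mono card_span_set assms)
    finally show "card ?H \<le> card ?K" .
  qed
  thus ?thesis by (simp add: hilb_def card)
qed

section \<open>Compatible sets\<close>

text \<open>\<open>F\<close> collects the indices whose label is in range, \<open>R\<close> those
  that are in range themselves as well. Either the two agree, or \<open>R\<close> is all of
  \<open>{m..d}\<close> and the minimum is its size \<open>Suc d - m\<close>.\<close>

lemma string_rank_compatible:
  assumes "compatible c d w" "s \<in> all_strings"
  shows "string_rank d (w ` {c..d}) s = card {t \<in> {c..d}. s \<in> strings t \<and> s \<in> strings (w t)}"
proof -
  define m where "m = fst s"
  define R where "R = {t \<in> {c..d}. s \<in> strings t \<and> s \<in> strings (w t)}"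
  have inj: "inj_on w {c..d}" and ge: "\<And>t. t \<in> {c..d} \<Longrightarrow> t \<le> w t"
    and gt: "\<And>t. t \<in> {c..d} \<Longrightarrow> w t \<noteq> t \<Longrightarrow> d < w t"
    and anti: "\<And>s t. s \<in> {c..d} \<Longrightarrow> t \<in> {c..d} \<Longrightarrow> s < t \<Longrightarrow> d < w s \<Longrightarrow> d < w t \<Longrightarrow> w t < w s"
    using assms(1) by (auto simp: compatible_def)
  note iff = all_strings_strings_iff[OF assms(2), folded m_def]
  \<comment> \<open>Because \<open>t \<le> w t\<close>, only the lower bound on \<open>t\<close> and
    the upper bound on \<open>w t\<close> matter.\<close>
  have R: "R = {t \<in> {c..d}. m \<le> t \<and> m + w t \<le> max_wt}"
    using ge unfolding R_def iff by fastforce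
  define F where "F = {t \<in> {c..d}. m \<le> w t \<and> m + w t \<le> max_wt}"
  have "hits (w ` {c..d}) s = w ` F" by (auto simp: hits_def iff F_def)
  hence cF: "card (hits (w ` {c..d}) s) = card F"
    using inj by (auto simp: F_def intro!: card_image inj_on_subset[OF inj])
  have fin: "finite F" "finite R" by (auto simp: F_def R)
  have RF: "R \<subseteq> F" using ge by (fastforce simp: R F_def)
  have "R \<subseteq> {m..d}" by (auto simp: R)
  from card_mono[OF _ this] have Rd: "card R \<le> Suc d - m" by simp
  have "min (Suc d - m) (card F) = card R"
  proof (cases "F = R")
    case True
    thus ?thesis using Rd by simp
  next
    case False
    (* An index below m labelling a layer in range pushes all labels of m, ..., d into range. *)
    then obtain u where u: "u \<in> F" "u \<notin> R" using RF by blast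
    hence u': "u \<in> {c..d}" "u < m" "m \<le> w u" "m + w u \<le> max_wt" by (auto simp: F_def R)
    hence wu: "d < w u" using gt[of u] by auto
    have "{m..d} \<subseteq> R"
    proof
      fix t assume t: "t \<in> {m..d}"
      hence t': "t \<in> {c..d}" "u < t" using u' by auto
      \<comment> \<open>If \<open>w t = t\<close>, then \<open>w t \<le> d < w u\<close>; otherwise
        both labels exceed \<open>d\<close> and the order reversal applies.\<close>
      have "w t < w u"
        using anti[OF u'(1) t' wu] gt[OF t'(1)] wu t by (cases "w t = t") auto
      thus "t \<in> R" using t t' u' by (auto simp: R)
    qed
    from card_mono[OF fin(2) this] Rd have "card R = Suc d - m" by simp
    thus ?thesis using card_mono[OF fin(1) RF] by simp
  qed
  thus ?thesis unfolding string_rank_def cF R_def[symmetric] m_def[symmetric] .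
qed

text \<open>The sets \<open>strings i\<close> are nested according to
  \<open>min i (max_wt - i)\<close>, so the smaller of two is their intersection.\<close>

lemma min_layer_size:
  assumes "i \<le> max_wt" "j \<le> max_wt"
  shows "min (layer_size n k i) (layer_size n k j) = card {s \<in> all_strings. s \<in> strings i \<and> s \<in> strings j}"
proof -
  have "strings i \<subseteq> strings j \<or> strings j \<subseteq> strings i"
    unfolding strings_def using assms by (cases "min i (max_wt - i) \<le> min j (max_wt - j)") auto
  moreover have "{s \<in> all_strings. s \<in> strings i \<and> s \<in> strings j} = strings i \<inter> strings j"
    using strings_subset by auto
  ultimately show ?thesis
    unfolding card_strings[OF assms(1), symmetric] card_strings[OF assms(2), symmetric]
    using card_mono[OF finite_strings, of "strings i" j] card_mono[OF finite_strings, of "strings j" i]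
    by (auto simp: Int_absorb1 Int_absorb2 min_def)
qed

end

theorem theorem4p1:
  fixes n c d N :: nat and k w :: "nat \<Rightarrow> nat" and E :: "nat set"
  assumes "\<And>i. i \<in> {1..n} \<Longrightarrow> k i \<ge> 2"
    and "N = (\<Sum>i\<in>{1..n}. k i - 1)"
    and "c \<le> d" and "{c..d} \<subseteq> {0..N}"
    and "E = w ` {c..d}" and "E \<subseteq> {0..N}"
    and "compatible c d w"
  shows "hilb n d (layers n k E) =
           (\<Sum>t\<in>{c..d}. min (layer_size n k t) (layer_size n k (w t)))"
proof -
  interpret rect_grid n k .
  have N: "max_wt = N" using assms(2) by (simp add: max_wt_def)
  have "hilb n d (layers n k E) = (\<Sum>s\<in>all_strings. string_rank d E s)"
    by (rule hilb_eq_sum_rank) (simp add: assms(5))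
  also have "\<dots> = (\<Sum>s\<in>all_strings. card {t \<in> {c..d}. s \<in> strings t \<and> s \<in> strings (w t)})"
    unfolding assms(5) by (intro sum.cong refl string_rank_compatible assms(7))
  \<comment> \<open>Double counting of the pairs of a string and an index \<open>t\<close> with both
    layers on the string.\<close>
  also have "\<dots> = (\<Sum>t\<in>{c..d}. card {s \<in> all_strings. s \<in> strings t \<and> s \<in> strings (w t)})"
    by (rule sum_multicount_gen) (auto simp: finite_all_strings)
  also have "\<dots> = (\<Sum>t\<in>{c..d}. min (layer_size n k t) (layer_size n k (w t)))"
    using assms(4-6) by (intro sum.cong refl min_layer_size[symmetric]) (auto simp: N image_subset_iff)
  finally show ?thesis .
qed

end
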